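(* Let $\eta \in (0,1]$ and $\delta > 0$. There is a constant $\kappa(\eta,\delta) > 0$ depending only on $\eta$ and $\delta$ such that the following holds. Let $X = \{x_1,\ldots,x_n\} \subseteq B_2^d$ (the unit Euclidean ball) satisfy the $\ell_2^2$ triangle inequalities $\|x_i - x_j\|_2^2 + \|x_j - x_k\|_2^2 \geq \|x_i - x_k\|_2^2$ for all $i,j,k$, with $\operatorname{ssr}_\eta(X) = r$, and suppose $\frac{1}{n^2}\sum_{i,j}\|x_i - x_j\|_2^2 \geq \delta$. Then there exist sets $A, B \subseteq X$ with $|A|, |B| \geq (\eta\delta/32)\, n$ and $\min_{x\in A, y \in B}\|x - y\|_2^2 \geq \kappa(\eta,\delta)/\sqrt{r}$.
   Context: For $\eta \in (0,1]$, a point set $X = \{x_1,\ldots,x_n\} \subseteq \mathbb{R}^d$ has $\eta$-subspace rank $r$, written $\operatorname{ssr}_\eta(X) = r$, if there exists an orthogonal projector $\Pi \in \mathbb{R}^{d\times d}$ of rank $r$ with $\sum_{i,j\in[n]} \|\Pi x_i - \Pi x_j\|_2^2 \geq \eta \sum_{i,j\in[n]} \|x_i - x_j\|_2^2$. *)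

theory Defs
  imports Complex_Main "Jordan_Normal_Form.DL_Rank"
begin

text \<open>
  The dimension \<open>d\<close> has to be quantified inside the scope of the constant
  \<open>\<kappa>\<close>, so it cannot be a type: points of \<open>\<real>\<^sup>d\<close> are
  elements of \<^term>\<open>carrier_vec d\<close>.  A point set \<open>{x\<^sub>1, \<dots>, x\<^sub>n}\<close> is
  given by an enumeration \<open>x\<close> on \<^term>\<open>{1..n::nat}\<close>, in which points may repeat
  and are then counted with multiplicity.
\<close>

definition l2_norm :: "real vec \<Rightarrow> real" where
  "l2_norm v = sqrt (v \<bullet> v)"

definition orthogonal_projector :: "nat \<Rightarrow> real mat \<Rightarrow> bool" where
  "orthogonal_projector d P \<longleftrightarrow>
     P \<in> carrier_mat d d \<and> P * P = P \<and> transpose_mat P = P"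

text \<open>
  \<open>ssr \<eta> d n x r\<close> reads \<open>ssr\<^sub>\<eta>(X) = r\<close> for \<open>X = {x\<^sub>1, \<dots>, x\<^sub>n}\<close> in \<open>\<real>\<^sup>d\<close>.  It is a
  relation, not a function: no minimality of \<open>r\<close> is required.
\<close>

definition ssr :: "real \<Rightarrow> nat \<Rightarrow> nat \<Rightarrow> (nat \<Rightarrow> real vec) \<Rightarrow> nat \<Rightarrow> bool" where
  "ssr \<eta> d n x r \<longleftrightarrow>
     (\<exists>P. orthogonal_projector d P \<and> vec_space.rank d P = r \<and>
        (\<Sum>i=1..n. \<Sum>j=1..n. (l2_norm (P *\<^sub>v x i - P *\<^sub>v x j))\<^sup>2)
          \<ge> \<eta> * (\<Sum>i=1..n. \<Sum>j=1..n. (l2_norm (x i - x j))\<^sup>2))"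

end

theory Submission
  imports Defs "HOL-Analysis.L2_Norm"
begin

text \<open>
  The argument is the chaining proof of the Arora--Rao--Vazirani structure theorem, with random signs
  in place of Gaussians and the rank \<open>r\<close> of the projector in place of \<open>log n\<close>.

  If some ball around a projected point contains many projected points, this ball and the complement
  of a concentric one are constantly separated.  Otherwise most projected pairs have constant distance, and
  for a random sign vector \<open>\<epsilon>\<close> the form \<open>t u = \<langle>\<epsilon>, \<Pi> (x u)\<rangle>\<close> separates many pairs by a constant
  \<open>\<sigma>\<close>.  If no large sets are \<open>\<Delta>\<close>-separated, then a maximal matching of pairs that are \<open>\<Delta>\<close>-close but
  separated by \<open>\<sigma>\<close> in \<open>t\<close> has linear expected size.  Composing matching edges, the average over \<open>u\<close>
  of the expected maximum of \<open>t w - t u\<close> over the \<open>k\<close>-step neighbours \<open>w\<close> of \<open>u\<close> grows linearly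
  in \<open>k\<close> as long as the standard deviation of this maximum, at most \<open>sqrt (2 * k * \<Delta>)\<close> by
  Efron--Stein, is small compared with \<open>\<sigma>\<close>.  But the expected maximum is at most
  \<open>sqrt r * sqrt (k * \<Delta>)\<close>, since \<open>\<parallel>\<Pi> \<epsilon>\<parallel>\<^sup>2\<close> has mean \<open>r\<close>.  For \<open>\<Delta>\<close> a small multiple of
  \<open>1 / sqrt r\<close> and \<open>k\<close> of order \<open>sqrt r\<close> this is a contradiction.
\<close>

section \<open>Rademacher averages\<close>

text \<open>A subset \<open>S\<close> of \<open>A\<close> encodes the sign vector that is \<open>1\<close> on \<open>S\<close> and \<open>-1\<close> on \<open>A - S\<close>, so that
  \<open>A - S\<close> encodes its negative.\<close>

definition ravg :: "'i set \<Rightarrow> ('i set \<Rightarrow> real) \<Rightarrow> real" where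
  "ravg A f = (\<Sum>S\<in>Pow A. f S) / 2 ^ card A"

definition rform :: "'i set \<Rightarrow> 'i set \<Rightarrow> ('i \<Rightarrow> real) \<Rightarrow> real" where
  "rform A S v = (\<Sum>i\<in>A. (if i \<in> S then 1 else - 1) * v i)"

text \<open>Conditioning on the sign at \<open>i\<close>; the inductions on sign coordinates below
  rest on it.\<close>

lemma ravg_insert:
  assumes "finite A" "i \<notin> A"
  shows "ravg (insert i A) f = ravg A (\<lambda>S. (f S + f (insert i S)) / 2)"
proof -
  have inj: "inj_on (insert i) (Pow A)"
    using assms(2) by (auto simp: inj_on_def) 
  have "(\<Sum>S\<in>Pow (insert i A). f S) = (\<Sum>S\<in>Pow A. f S) + (\<Sum>S\<in>insert i ` Pow A. f S)"
    unfolding Pow_insert using assms by (intro sum.union_disjoint) auto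
  also have "\<dots> = (\<Sum>S\<in>Pow A. f S + f (insert i S))"
    by (simp add: sum.reindex[OF inj] sum.distrib)
  finally show ?thesis
    using assms by (simp add: ravg_def sum_divide_distrib [symmetric])
qed

lemma ravg_empty [simp]: "ravg {} f = f {}"
  by (simp add: ravg_def)

lemma ravg_const [simp]: "finite A \<Longrightarrow> ravg A (\<lambda>_. c) = c"
  by (simp add: ravg_def card_Pow)

lemma ravg_add: "ravg A (\<lambda>S. f S + g S) = ravg A f + ravg A g"
  by (simp add: ravg_def sum.distrib add_divide_distrib)

lemma ravg_diff: "ravg A (\<lambda>S. f S - g S) = ravg A f - ravg A g"
  by (simp add: ravg_def sum_subtractf diff_divide_distrib)

lemma ravg_cmult: "ravg A (\<lambda>S. c * f S) = c * ravg A f"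
  by (simp add: ravg_def sum_distrib_left)

lemma ravg_sum: "ravg A (\<lambda>S. \<Sum>j\<in>B. f j S) = (\<Sum>j\<in>B. ravg A (f j))"
  unfolding ravg_def by (subst sum.swap) (simp add: sum_divide_distrib)

lemma ravg_mono: "(\<And>S. S \<subseteq> A \<Longrightarrow> f S \<le> g S) \<Longrightarrow> ravg A f \<le> ravg A g"
  unfolding ravg_def by (intro divide_right_mono sum_mono) auto

lemma ravg_cong: "(\<And>S. S \<subseteq> A \<Longrightarrow> f S = g S) \<Longrightarrow> ravg A f = ravg A g"
  unfolding ravg_def by (intro arg_cong2[where f="(/)"] sum.cong) auto

lemma ravg_compl: "ravg A (\<lambda>S. f (A - S)) = ravg A f"
proof -
  have "(\<Sum>S\<in>Pow A. f (A - S)) = (\<Sum>S\<in>Pow A. f S)"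
    by (rule sum.reindex_bij_witness[of _ "\<lambda>S. A - S" "\<lambda>S. A - S"]) (auto simp: double_diff)
  then show ?thesis by (simp add: ravg_def)
qed

lemma ravg_flip:
  assumes "i \<in> A"
  shows "ravg A (\<lambda>S. f (if i \<in> S then S - {i} else insert i S)) = ravg A f"
proof -
  let ?h = "\<lambda>S. if i \<in> S then S - {i} else insert i S"
  have "(\<Sum>S\<in>Pow A. f (?h S)) = (\<Sum>S\<in>Pow A. f S)"
    by (rule sum.reindex_bij_witness[of _ ?h ?h]) (use assms in \<open>auto split: if_splits\<close>)
  then show ?thesis by (simp add: ravg_def)
qed

lemma ravg_square_dev:
  assumes "finite A"
  shows "ravg A (\<lambda>S. (f S - ravg A f)\<^sup>2) = ravg A (\<lambda>S. (f S)\<^sup>2) - (ravg A f)\<^sup>2"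
proof -
  let ?m = "ravg A f"
  have "ravg A (\<lambda>S. (f S - ?m)\<^sup>2) = ravg A (\<lambda>S. ((f S)\<^sup>2 - (2 * ?m) * f S) + ?m\<^sup>2)"
    by (intro ravg_cong) (simp add: power2_diff)
  also have "\<dots> = ravg A (\<lambda>S. (f S)\<^sup>2) - 2 * ?m * ?m + ?m\<^sup>2"
    using assms by (simp add: ravg_add ravg_diff ravg_cmult)
  finally show ?thesis by (simp add: power2_eq_square)
qed

lemma ravg_square_le:
  assumes "finite A"
  shows "(ravg A f)\<^sup>2 \<le> ravg A (\<lambda>S. (f S)\<^sup>2)"
proof -
  have "0 \<le> ravg A (\<lambda>S. (f S - ravg A f)\<^sup>2)"
    by (simp add: ravg_def sum_nonneg)
  then show ?thesis using ravg_square_dev[OF assms, of f] by linarith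
qed

lemma ravg_le_sqrt:
  assumes "finite A" "ravg A (\<lambda>S. (f S)\<^sup>2) \<le> b"
  shows "ravg A f \<le> sqrt b"
  using ravg_square_le[OF assms(1), of f] assms(2) by (intro real_le_rsqrt) linarith

text \<open>Averaging over the sign at \<open>i\<close> turns \<open>f\<close> into \<open>g\<close>
  and costs a quarter of the mean squared difference in direction \<open>i\<close>. In another
  direction \<open>j\<close> the difference of \<open>g\<close> is the mean of two differences of
  \<open>f\<close>, so convexity of the square bounds it and the induction closes.\<close>

lemma efron_stein:
  assumes "finite A"
  shows "ravg A (\<lambda>S. (f S)\<^sup>2) - (ravg A f)\<^sup>2
    \<le> (\<Sum>i\<in>A. ravg A (\<lambda>S. (f (insert i S) - f (S - {i}))\<^sup>2)) / 4"
  using assms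
proof (induction A arbitrary: f rule: finite_induct)
  case empty
  then show ?case by simp
next
  case (insert i A)
  define g where "g S = (f S + f (insert i S)) / 2" for S
  have avg: "ravg (insert i A) f = ravg A g"
    unfolding ravg_insert[OF insert.hyps] by (intro ravg_cong) (simp add: g_def)
  have "ravg (insert i A) (\<lambda>S. (f S)\<^sup>2)
      = ravg A (\<lambda>S. (g S)\<^sup>2 + (1/4) * (f (insert i S) - f S)\<^sup>2)"
    unfolding ravg_insert[OF insert.hyps]
    by (intro ravg_cong) (simp add: g_def power2_eq_square field_simps)
  then have sq: "ravg (insert i A) (\<lambda>S. (f S)\<^sup>2)
      = ravg A (\<lambda>S. (g S)\<^sup>2) + ravg A (\<lambda>S. (f (insert i S) - f S)\<^sup>2) / 4"
    by (simp only: ravg_add ravg_cmult)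
  have i: "ravg (insert i A) (\<lambda>S. (f (insert i S) - f (S - {i}))\<^sup>2)
      = ravg A (\<lambda>S. (f (insert i S) - f S)\<^sup>2)"
    unfolding ravg_insert[OF insert.hyps]
  proof (intro ravg_cong)
    fix S assume "S \<subseteq> A"
    then have "S - {i} = S" "insert i S - {i} = S" using insert.hyps by auto
    then show "((f (insert i S) - f (S - {i}))\<^sup>2
        + (f (insert i (insert i S)) - f (insert i S - {i}))\<^sup>2) / 2 = (f (insert i S) - f S)\<^sup>2"
      by simp
  qed
  have j: "ravg A (\<lambda>S. (g (insert j S) - g (S - {j}))\<^sup>2)
      \<le> ravg (insert i A) (\<lambda>S. (f (insert j S) - f (S - {j}))\<^sup>2)" if "j \<in> A" for j
    unfolding ravg_insert[OF insert.hyps]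
  proof (intro ravg_mono)
    fix S assume "S \<subseteq> A"
    have "i \<noteq> j" using that insert.hyps by auto
    then have *: "insert i (S - {j}) = insert i S - {j}" by auto
    have **: "((a + b) / 2)\<^sup>2 \<le> (a\<^sup>2 + b\<^sup>2) / 2" for a b :: real
      using zero_le_power2[of "a - b"] by (simp add: power2_eq_square field_simps)
    have "g (insert j S) - g (S - {j}) = ((f (insert j S) - f (S - {j}))
        + (f (insert j (insert i S)) - f (insert i S - {j}))) / 2"
      by (simp add: g_def * insert_commute field_simps)
    then show "(g (insert j S) - g (S - {j}))\<^sup>2 \<le> ((f (insert j S) - f (S - {j}))\<^sup>2
        + (f (insert j (insert i S)) - f (insert i S - {j}))\<^sup>2) / 2"
      using ** by metis
  qed
  have "(\<Sum>j\<in>A. ravg A (\<lambda>S. (g (insert j S) - g (S - {j}))\<^sup>2))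
      \<le> (\<Sum>j\<in>A. ravg (insert i A) (\<lambda>S. (f (insert j S) - f (S - {j}))\<^sup>2))"
    by (intro sum_mono j)
  then show ?case
    using insert.IH[of g] insert.hyps by (simp add: sq avg i)
qed

section \<open>Linear forms in random signs and their maxima\<close>

lemma rform_diff: "rform A S (\<lambda>i. v i - w i) = rform A S v - rform A S w"
  by (simp add: rform_def right_diff_distrib sum_subtractf)

lemma rform_compl: "rform A (A - S) v = - rform A S v"
  unfolding rform_def sum_negf [symmetric] by (intro sum.cong) auto

lemma rform_flip:
  assumes "finite A" "i \<in> A"
  shows "rform A (if i \<in> S then S - {i} else insert i S) v \<ge> rform A S v - 2 * \<bar>v i\<bar>"
proof -
  let ?T = "if i \<in> S then S - {i} else insert i S"
  have "(\<Sum>j\<in>A - {i}. (if j \<in> ?T then 1 else - 1) * v j)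
      = (\<Sum>j\<in>A - {i}. (if j \<in> S then 1 else - 1) * v j)"
    by (intro sum.cong) auto
  then show ?thesis
    unfolding rform_def sum.remove[OF assms] by (auto simp: abs_if)
qed

text \<open>Efron--Stein with the maximiser \<open>t S\<close> tracked: flipping sign
  \<open>i\<close> lowers the maximum by at most \<open>2 * \<bar>z (t S) i\<bar>\<close>, as the
  old maximiser still competes. Summed over \<open>i\<close>, only the squared length of one vector
  appears, so the number of forms does not enter.\<close>

lemma variance_Max_rform:
  fixes z :: "'b \<Rightarrow> 'i \<Rightarrow> real"
  assumes A: "finite A" and T: "finite T" "T \<noteq> {}"
    and s: "\<And>t. t \<in> T \<Longrightarrow> (\<Sum>i\<in>A. (z t i)\<^sup>2) \<le> s"
  defines "f \<equiv> \<lambda>S. Max ((\<lambda>t. rform A S (z t)) ` T)"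
  shows "ravg A (\<lambda>S. (f S - ravg A f)\<^sup>2) \<le> 2 * s"
proof -
  have "\<exists>t\<in>T. f S = rform A S (z t)" for S
  proof -
    have "f S \<in> (\<lambda>t. rform A S (z t)) ` T" unfolding f_def using T by (intro Max_in) auto
    then show ?thesis by auto
  qed
  then obtain t where t: "\<And>S. t S \<in> T" "\<And>S. f S = rform A S (z (t S))" by metis
  have ge: "f S \<ge> rform A S (z u)" if "u \<in> T" for S u
    unfolding f_def using that T by (intro Max_ge) auto
  have i: "ravg A (\<lambda>S. (f (insert i S) - f (S - {i}))\<^sup>2)
      \<le> 8 * ravg A (\<lambda>S. (z (t S) i)\<^sup>2)" if i: "i \<in> A" for i
  proof -
    let ?h = "\<lambda>S. if i \<in> S then S - {i} else insert i S"
    have drop: "f S - f (?h S) \<le> 2 * \<bar>z (t S) i\<bar>" for S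
      using rform_flip[OF A i, of S "z (t S)"] ge[OF t(1)[of S], of "?h S"] t(2)[of S]
      by linarith
    \<comment> \<open>Either sign of \<open>i\<close> may give the larger maximum, so both
      maximisers enter; \<open>ravg_flip\<close> then merges the two terms.\<close>
    have "(f (insert i S) - f (S - {i}))\<^sup>2 \<le> 4 * (z (t S) i)\<^sup>2 + 4 * (z (t (?h S)) i)\<^sup>2" for S
    proof -
      have hh: "?h (?h S) = S" by auto
      have "f (?h S) - f S \<le> 2 * \<bar>z (t (?h S)) i\<bar>" using drop[of "?h S"] unfolding hh .
      then have "\<bar>f S - f (?h S)\<bar> \<le> max (2 * \<bar>z (t S) i\<bar>) (2 * \<bar>z (t (?h S)) i\<bar>)"
        using drop[of S] by linarith
      then have "(f S - f (?h S))\<^sup>2 \<le> (max (2 * \<bar>z (t S) i\<bar>) (2 * \<bar>z (t (?h S)) i\<bar>))\<^sup>2"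
        by (metis abs_ge_zero power2_abs power_mono)
      also have "\<dots> \<le> 4 * (z (t S) i)\<^sup>2 + 4 * (z (t (?h S)) i)\<^sup>2"
        by (auto simp: max_def power_mult_distrib)
      finally show ?thesis
        by (cases "i \<in> S") (auto simp: insert_absorb power2_commute)
    qed
    then have "ravg A (\<lambda>S. (f (insert i S) - f (S - {i}))\<^sup>2)
        \<le> ravg A (\<lambda>S. 4 * (z (t S) i)\<^sup>2 + 4 * (z (t (?h S)) i)\<^sup>2)"
      by (intro ravg_mono) auto
    also have "\<dots> = 8 * ravg A (\<lambda>S. (z (t S) i)\<^sup>2)"
      using ravg_flip[OF i, of "\<lambda>S. (z (t S) i)\<^sup>2"] by (simp add: ravg_add ravg_cmult)
    finally show ?thesis .
  qed
  have "ravg A (\<lambda>S. (f S - ravg A f)\<^sup>2)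
      \<le> (\<Sum>i\<in>A. ravg A (\<lambda>S. (f (insert i S) - f (S - {i}))\<^sup>2)) / 4"
    using efron_stein[OF A, of f] ravg_square_dev[OF A, of f] by simp
  also have "\<dots> \<le> (\<Sum>i\<in>A. 8 * ravg A (\<lambda>S. (z (t S) i)\<^sup>2)) / 4"
    by (intro divide_right_mono sum_mono i) auto
  also have "\<dots> = 2 * ravg A (\<lambda>S. \<Sum>i\<in>A. (z (t S) i)\<^sup>2)"
    by (simp add: ravg_sum sum_distrib_left [symmetric])
  also have "\<dots> \<le> 2 * ravg A (\<lambda>S. s)"
    by (intro mult_left_mono ravg_mono s t) auto
  finally show ?thesis using A by simp
qed

section \<open>Moments and anticoncentration of a single form\<close>

lemma rform_insert:
  assumes "finite A" "i \<notin> A" "S \<subseteq> A"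
  shows "rform (insert i A) S v = rform A S v - v i"
    "rform (insert i A) (insert i S) v = rform A S v + v i"
proof -
  have "(\<Sum>j\<in>A. (if j \<in> insert i S then 1 else - 1) * v j)
      = (\<Sum>j\<in>A. (if j \<in> S then 1 else - 1) * v j)"
    using assms by (intro sum.cong) auto
  then show "rform (insert i A) S v = rform A S v - v i"
    "rform (insert i A) (insert i S) v = rform A S v + v i"
    using assms by (auto simp: rform_def)
qed

lemma ravg_rform_square:
  assumes "finite A"
  shows "ravg A (\<lambda>S. (rform A S v)\<^sup>2) = (\<Sum>i\<in>A. (v i)\<^sup>2)"
  using assms
proof (induction A rule: finite_induct)
  case empty
  then show ?case by (simp add: rform_def)
next
  case (insert i A)
  have "ravg (insert i A) (\<lambda>S. (rform (insert i A) S v)\<^sup>2)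
      = ravg A (\<lambda>S. (rform A S v)\<^sup>2 + (v i)\<^sup>2)"
    unfolding ravg_insert[OF insert.hyps]
    by (intro ravg_cong)
      (simp add: rform_insert[OF insert.hyps] power2_eq_square field_simps)
  then show ?case using insert by (simp add: ravg_add)
qed

text \<open>Odd powers of \<open>v i\<close> cancel between the two signs, and the remaining mixed
  term, with coefficient 6, is exactly the one produced by the square on the right.\<close>

lemma ravg_rform_fourth_power:
  assumes "finite A"
  shows "ravg A (\<lambda>S. (rform A S v)^4) \<le> 3 * (\<Sum>i\<in>A. (v i)\<^sup>2)\<^sup>2"
  using assms
proof (induction A rule: finite_induct)
  case empty
  then show ?case by (simp add: rform_def)
next
  case (insert i A)
  let ?s = "\<Sum>i\<in>A. (v i)\<^sup>2"
  have "ravg (insert i A) (\<lambda>S. (rform (insert i A) S v)^4)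
      = ravg A (\<lambda>S. (rform A S v)^4 + (6 * (v i)\<^sup>2) * (rform A S v)\<^sup>2 + (v i)^4)"
    unfolding ravg_insert[OF insert.hyps]
    by (intro ravg_cong)
      (simp add: rform_insert[OF insert.hyps] eval_nat_numeral algebra_simps)
  also have "\<dots> \<le> 3 * ?s\<^sup>2 + 6 * (v i)\<^sup>2 * ?s + (v i)^4"
    using insert ravg_rform_square[of A v] by (simp add: ravg_add ravg_cmult)
  also have "\<dots> \<le> 3 * ((v i)\<^sup>2 + ?s)\<^sup>2"
    using zero_le_even_power[of 4 "v i"] by (simp add: power2_sum power_mult_distrib algebra_simps flip: power_mult)
  finally show ?case using insert.hyps by simp
qed

text \<open>
  Paley--Zygmund: \<open>2 w l - (w l)\<^sup>2\<close> is a lower bound for the indicator of \<open>w \<ge> 0\<close> when \<open>l \<ge> 0\<close>;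
  it is used with \<open>w = (rform A S v)\<^sup>2 - s / 25\<close> and \<open>l = 1 / (3 * s)\<close>.
\<close>

lemma rform_anticoncentration:
  assumes A: "finite A"
  shows "63 / 200 \<le> ravg A (\<lambda>S. of_bool ((\<Sum>i\<in>A. (v i)\<^sup>2) \<le> 25 * (rform A S v)\<^sup>2))"
proof -
  define s where "s = (\<Sum>i\<in>A. (v i)\<^sup>2)"
  have "0 \<le> s" by (simp add: s_def sum_nonneg)
  show ?thesis
  proof (cases "s = 0")
    case True
    then show ?thesis using A by (simp add: s_def [symmetric])
  next
    case False
    then have s: "s > 0" using \<open>0 \<le> s\<close> by simp
    have "63 / 200 \<le> (2 / 3) * (24 / 25) - (1 / 9) * (3 - 2 / 25 + (1/25)\<^sup>2 :: real)"
      by (simp add: power2_eq_square)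
    also have "\<dots> = 2 / (3 * s) * (s - s / 25)
        - 1 / (9 * s\<^sup>2) * (3 * s\<^sup>2 - 2 * (s / 25) * s + (s / 25)\<^sup>2)"
      using s by (simp add: field_simps power2_eq_square)
    also have "\<dots> \<le> 2 / (3 * s) * (s - s / 25)
        - 1 / (9 * s\<^sup>2) * (ravg A (\<lambda>S. (rform A S v)^4) - 2 * (s / 25) * s + (s / 25)\<^sup>2)"
      using ravg_rform_fourth_power[OF A, of v]
      by (intro diff_left_mono mult_left_mono) (auto simp: s_def)
    also have "\<dots> = ravg A (\<lambda>S. 2 / (3 * s) * ((rform A S v)\<^sup>2 - s / 25)
        - 1 / (9 * s\<^sup>2) * ((rform A S v)^4 - 2 * (s / 25) * (rform A S v)\<^sup>2 + (s / 25)\<^sup>2))"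
      using A by (simp only: ravg_diff ravg_add ravg_cmult ravg_const ravg_rform_square[OF A]
          s_def [symmetric])
    also have "\<dots> \<le> ravg A (\<lambda>S. of_bool (s \<le> 25 * (rform A S v)\<^sup>2))"
    proof (intro ravg_mono)
      fix S
      define w where "w = ((rform A S v)\<^sup>2 - s / 25) / (3 * s)"
      have "2 / (3 * s) * ((rform A S v)\<^sup>2 - s / 25)
        - 1 / (9 * s\<^sup>2) * ((rform A S v)^4 - 2 * (s / 25) * (rform A S v)\<^sup>2 + (s / 25)\<^sup>2)
        = 2 * w - w\<^sup>2"
        using s by (simp add: w_def field_simps eval_nat_numeral)
      also have "\<dots> \<le> of_bool (s \<le> 25 * (rform A S v)\<^sup>2)"
      proof (cases "s \<le> 25 * (rform A S v)\<^sup>2")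
        case True
        then show ?thesis using zero_le_power2[of "w - 1"] by (simp add: power2_diff)
      next
        case False
        then have "w \<le> 0" using s by (simp add: w_def divide_le_0_iff)
        then show ?thesis using False by simp (smt (verit) zero_le_power2)
      qed
      finally show "2 / (3 * s) * ((rform A S v)\<^sup>2 - s / 25)
        - 1 / (9 * s\<^sup>2) * ((rform A S v)^4 - 2 * (s / 25) * (rform A S v)\<^sup>2 + (s / 25)\<^sup>2)
        \<le> of_bool (s \<le> 25 * (rform A S v)\<^sup>2)" .
    qed
    finally show ?thesis by (simp add: s_def)
  qed
qed

section \<open>Matchings of close points separated by a linear form\<close>

text \<open>Allows vertex sums to be compared edge by edge: injectivity and disjointness make every
  matched vertex occur in one edge only.\<close>

lemma sum_matching:
  fixes f :: "'a \<Rightarrow> 'b :: comm_monoid_add"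
  assumes "finite V" "M \<subseteq> V \<times> V" "inj_on fst M" "inj_on snd M" "fst ` M \<inter> snd ` M = {}"
  shows "(\<Sum>w\<in>V. f w)
    = (\<Sum>w\<in>V - (fst ` M \<union> snd ` M). f w) + (\<Sum>e\<in>M. f (fst e) + f (snd e))"
proof -
  have M: "finite M" using finite_subset[OF assms(2)] assms(1) by simp
  have sub: "fst ` M \<union> snd ` M \<subseteq> V" using assms(2) by auto
  have "(\<Sum>w\<in>V. f w) = (\<Sum>w\<in>V - (fst ` M \<union> snd ` M). f w) + (\<Sum>w\<in>fst ` M \<union> snd ` M. f w)"
    by (rule sum.subset_diff[OF sub assms(1)])
  also have "(\<Sum>w\<in>fst ` M \<union> snd ` M. f w) = (\<Sum>w\<in>fst ` M. f w) + (\<Sum>w\<in>snd ` M. f w)"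
    using M assms(5) by (intro sum.union_disjoint) auto
  also have "\<dots> = (\<Sum>e\<in>M. f (fst e) + f (snd e))"
    by (simp add: sum.reindex assms sum.distrib)
  finally show ?thesis .
qed

text \<open>An inclusion-maximal matching works, since an edge between unmatched vertices could be
  added. Irreflexivity gives that edge distinct ends, which keeps first and second components
  disjoint.\<close>

lemma maximal_matching_exists:
  fixes E :: "'a \<Rightarrow> 'a \<Rightarrow> bool"
  assumes V: "finite V" and irrefl: "\<And>u. \<not> E u u"
  obtains M where "M \<subseteq> V \<times> V" "inj_on fst M" "inj_on snd M" "fst ` M \<inter> snd ` M = {}"
    "\<And>u v. (u, v) \<in> M \<Longrightarrow> E u v"
    "\<And>u v. u \<in> V - (fst ` M \<union> snd ` M) \<Longrightarrow> v \<in> V - (fst ` M \<union> snd ` M) \<Longrightarrow> \<not> E u v"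
proof -
  define Q where "Q M \<longleftrightarrow> M \<subseteq> V \<times> V \<and> inj_on fst M \<and> inj_on snd M
    \<and> fst ` M \<inter> snd ` M = {} \<and> (\<forall>(u, v)\<in>M. E u v)" for M
  have fin: "finite {M. Q M}"
    by (rule finite_subset[of _ "Pow (V \<times> V)"]) (use V in \<open>auto simp: Q_def\<close>)
  have "Q {}" by (simp add: Q_def)
  then obtain M where M: "Q M" and max: "\<And>M'. Q M' \<Longrightarrow> M \<subseteq> M' \<Longrightarrow> M = M'"
    using finite_has_maximal[OF fin] by auto
  have "\<not> E u v" if "u \<in> V - (fst ` M \<union> snd ` M)" "v \<in> V - (fst ` M \<union> snd ` M)" for u v
  proof
    assume E: "E u v"
    then have "u \<noteq> v" using irrefl by auto
    then have "Q (insert (u, v) M)"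
      using M that E unfolding Q_def by (auto simp: image_iff inj_on_def)
    then have "(u, v) \<in> M" using max[of "insert (u, v) M"] by auto
    then show False using that by force
  qed
  then show ?thesis using M that[of M] unfolding Q_def by blast
qed

text \<open>\<open>W\<close> is \<open>U\<close> without the two tails of \<open>t\<close>, of at most \<open>m\<close> points each.\<close>

lemma trimmed_oscillation:
  fixes t :: "'a \<Rightarrow> real"
  assumes U: "finite U" and m: "0 < m"
    and nosep: "\<And>A B. A \<subseteq> U \<Longrightarrow> B \<subseteq> U \<Longrightarrow> m \<le> real (card A) \<Longrightarrow> m \<le> real (card B) \<Longrightarrow>
      \<exists>u\<in>A. \<exists>v\<in>B. t v - t u < \<sigma>"
  obtains W where "W \<subseteq> U" "real (card U) \<le> real (card W) + 2 * m"
    "\<And>x y. x \<in> W \<Longrightarrow> y \<in> W \<Longrightarrow> \<bar>t x - t y\<bar> < \<sigma>"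
proof -
  define L where "L = {x\<in>U. real (card {y\<in>U. t y \<le> t x}) < m}"
  define H where "H = {x\<in>U. real (card {y\<in>U. t x \<le> t y}) < m}"
  have L: "real (card L) \<le> m"
  proof (cases "L = {}")
    case False
    moreover have "finite L" using U by (simp add: L_def)
    ultimately obtain x where x: "x \<in> L" "\<And>y. y \<in> L \<Longrightarrow> t y \<le> t x"
      using ex_is_arg_min_if_finite[of L "\<lambda>x. - t x"] by (auto simp: is_arg_min_linorder)
    \<comment> \<open>The highest point of \<open>L\<close> has all of \<open>L\<close> at or below
      it, and by definition fewer than \<open>m\<close> points lie there.\<close>
    then have "card L \<le> card {y\<in>U. t y \<le> t x}"
      using U by (intro card_mono) (auto simp: L_def)
    then show ?thesis using x(1) by (auto simp: L_def)
  qed (use m in simp)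
  have H: "real (card H) \<le> m"
  proof (cases "H = {}")
    case False
    moreover have "finite H" using U by (simp add: H_def)
    ultimately obtain x where x: "x \<in> H" "\<And>y. y \<in> H \<Longrightarrow> t x \<le> t y"
      using ex_is_arg_min_if_finite[of H t] by (auto simp: is_arg_min_linorder)
    then have "card H \<le> card {y\<in>U. t x \<le> t y}"
      using U by (intro card_mono) (auto simp: H_def)
    then show ?thesis using x(1) by (auto simp: H_def)
  qed (use m in simp)
  have less: "t y - t x < \<sigma>" if xy: "x \<in> U - L" "y \<in> U - H" for x y
  proof -
    \<comment> \<open>At least \<open>m\<close> points lie at or below \<open>x\<close> and at least
      \<open>m\<close> at or above \<open>y\<close>, so \<open>nosep\<close> gives a gap below
      \<open>\<sigma>\<close> that dominates \<open>t y - t x\<close>.\<close>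
    obtain u v where "t u \<le> t x" "t y \<le> t v" "t v - t u < \<sigma>"
      using nosep[of "{u\<in>U. t u \<le> t x}" "{v\<in>U. t y \<le> t v}"] xy
      by (auto simp: L_def H_def not_less)
    then show ?thesis by linarith
  qed
  have "card U \<le> card (U - (L \<union> H)) + card (L \<union> H)"
    by (rule diff_card_le_card_Diff[THEN le_diff_conv[THEN iffD1]])
      (use U in \<open>simp add: L_def H_def\<close>)
  then have "real (card U) \<le> real (card (U - (L \<union> H))) + 2 * m"
    using L H card_Un_le[of L H] by linarith
  moreover have "\<bar>t x - t y\<bar> < \<sigma>" if "x \<in> U - (L \<union> H)" "y \<in> U - (L \<union> H)" for x y
    using less[of x y] less[of y x] that by (auto simp: abs_less_iff)
  ultimately show ?thesis using that[of "U - (L \<union> H)"] by blast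
qed

text \<open>Take a maximal matching of close pairs with gap at least \<open>\<sigma>\<close>. Large
  sets of unmatched points contain a close pair, whose gap must be small, so trimming applies to
  them. Every pair with a large absolute gap then meets \<open>V - W\<close>, which has at most
  \<open>2 * m + 2 * card M\<close> points.\<close>

lemma large_matching:
  fixes t :: "'a \<Rightarrow> real" and D :: "'a \<Rightarrow> 'a \<Rightarrow> real"
  assumes V: "finite V" and m: "0 < m" and \<sigma>: "0 < \<sigma>"
    and nosep: "\<And>A B. A \<subseteq> V \<Longrightarrow> B \<subseteq> V \<Longrightarrow> m \<le> real (card A) \<Longrightarrow> m \<le> real (card B) \<Longrightarrow>
      \<exists>u\<in>A. \<exists>v\<in>B. D u v < \<Delta>"
  obtains M where "M \<subseteq> V \<times> V" "inj_on fst M" "inj_on snd M" "fst ` M \<inter> snd ` M = {}"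
    "\<And>u v. (u, v) \<in> M \<Longrightarrow> D u v < \<Delta> \<and> \<sigma> \<le> t v - t u"
    "(\<Sum>x\<in>V. \<Sum>y\<in>V. of_bool (\<sigma> \<le> \<bar>t x - t y\<bar>)) \<le> 4 * real (card V) * (m + real (card M))"
proof -
  obtain M where M: "M \<subseteq> V \<times> V" "inj_on fst M" "inj_on snd M" "fst ` M \<inter> snd ` M = {}"
    "\<And>u v. (u, v) \<in> M \<Longrightarrow> D u v < \<Delta> \<and> \<sigma> \<le> t v - t u"
    and max: "\<And>u v. u \<in> V - (fst ` M \<union> snd ` M) \<Longrightarrow> v \<in> V - (fst ` M \<union> snd ` M) \<Longrightarrow>
      \<not> (D u v < \<Delta> \<and> \<sigma> \<le> t v - t u)"
  proof (rule maximal_matching_exists[OF V, of "\<lambda>u v. D u v < \<Delta> \<and> \<sigma> \<le> t v - t u"])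
    show "\<not> (D u u < \<Delta> \<and> \<sigma> \<le> t u - t u)" for u using \<sigma> by simp
  qed (rule that)
  define U where "U = V - (fst ` M \<union> snd ` M)"
  have "\<exists>u\<in>A. \<exists>v\<in>B. t v - t u < \<sigma>"
    if AB: "A \<subseteq> U" "B \<subseteq> U" "m \<le> real (card A)" "m \<le> real (card B)" for A B
  proof -
    have "A \<subseteq> V" "B \<subseteq> V" using AB(1,2) by (auto simp: U_def)
    then obtain u v where uv: "u \<in> A" "v \<in> B" "D u v < \<Delta>"
      using nosep[OF _ _ AB(3,4)] by blast
    then have "\<not> (D u v < \<Delta> \<and> \<sigma> \<le> t v - t u)"
      using max[of u v] AB(1,2) unfolding U_def by blast
    then show ?thesis using uv by (meson not_le)
  qed
  then obtain W where W: "W \<subseteq> U" "real (card U) \<le> real (card W) + 2 * m"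
    "\<And>x y. x \<in> W \<Longrightarrow> y \<in> W \<Longrightarrow> \<bar>t x - t y\<bar> < \<sigma>"
    using trimmed_oscillation[of U m t \<sigma>] V m finite_Diff[OF V] unfolding U_def by metis
  have "(\<Sum>w\<in>V. 1) = (\<Sum>w\<in>U. 1) + (\<Sum>e\<in>M. 1 + (1::nat))"
    unfolding U_def by (rule sum_matching[OF V M(1-4)])
  then have "card V = card U + 2 * card M" by simp
  moreover have WV: "W \<subseteq> V" using W(1) by (auto simp: U_def)
  moreover have "card (V - W) + card W = card V"
    using WV V by (metis card_Diff_subset card_mono finite_subset le_add_diff_inverse2)
  ultimately have VW: "real (card (V - W)) \<le> 2 * m + 2 * real (card M)"
    using W(2) by linarith
  have "(\<Sum>x\<in>V. \<Sum>y\<in>V. of_bool (\<sigma> \<le> \<bar>t x - t y\<bar>))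
      \<le> (\<Sum>x\<in>V. \<Sum>y\<in>V. of_bool (x \<in> V - W) + of_bool (y \<in> V - W) :: real)"
  proof (intro sum_mono)
    fix x y assume "x \<in> V" "y \<in> V"
    then show "of_bool (\<sigma> \<le> \<bar>t x - t y\<bar>) \<le> (of_bool (x \<in> V - W) + of_bool (y \<in> V - W) :: real)"
      using W(3)[of x y] by (cases "x \<in> W"; cases "y \<in> W") auto
  qed
  also have "\<dots> = 2 * real (card V) * real (card (V - W))"
  proof -
    have "(\<Sum>y\<in>V. of_bool (y \<in> V - W) :: real) = (\<Sum>y\<in>V - W. 1)"
      using V by (intro sum.mono_neutral_cong_right) auto
    then have W': "(\<Sum>y\<in>V. of_bool (y \<in> V - W) :: real) = real (card (V - W))"
      by simp
    show ?thesis
      by (simp only: sum.distrib W' sum_constant flip: sum_distrib_left)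
  qed
  also have "\<dots> \<le> 2 * real (card V) * (2 * m + 2 * real (card M))"
    using VW by (intro mult_left_mono) auto
  finally have "(\<Sum>x\<in>V. \<Sum>y\<in>V. of_bool (\<sigma> \<le> \<bar>t x - t y\<bar>)) \<le> 4 * real (card V) * (m + real (card M))"
    by (simp add: algebra_simps)
  with M show ?thesis by (rule that)
qed

section \<open>Chaining\<close>

text \<open>
  \<open>Y k u S\<close> is the largest value of the random form on a walk of \<open>k\<close> steps of length below \<open>\<Delta>\<close> from \<open>u\<close>.
  A matched pair \<open>(u, v)\<close> gives \<open>Y (k + 1) u S \<ge> Y k v S + \<sigma>\<close> and, for the negated signs,
  \<open>Y (k + 1) v (A - S) \<ge> Y k u (A - S) + \<sigma>\<close>.  Adding the two makes every vertex occur equally often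
  on both sides, so that after replacing \<open>Y\<close> by its mean (at the cost of the deviation \<open>e\<close>) only
  the gain \<open>\<sigma>\<close> remains.
\<close>

lemma chaining_bound:
  fixes V :: "'a set" and A :: "'i set" and p :: "'a \<Rightarrow> 'i \<Rightarrow> real"
    and D :: "'a \<Rightarrow> 'a \<Rightarrow> real" and M :: "'i set \<Rightarrow> ('a \<times> 'a) set"
  assumes V: "finite V" and A: "finite A"
    and D_refl: "\<And>u. D u u = 0" and D_sym: "\<And>u v. D u v = D v u"
    and D_tri: "\<And>u v w. u \<in> V \<Longrightarrow> v \<in> V \<Longrightarrow> w \<in> V \<Longrightarrow> D u w \<le> D u v + D v w"
    and pD: "\<And>u v. u \<in> V \<Longrightarrow> v \<in> V \<Longrightarrow> (\<Sum>i\<in>A. (p u i - p v i)\<^sup>2) \<le> D u v"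
    and M: "\<And>S. M S \<subseteq> V \<times> V" "\<And>S. inj_on fst (M S)" "\<And>S. inj_on snd (M S)"
      "\<And>S. fst ` M S \<inter> snd ` M S = {}"
    and M_edge: "\<And>S u v. (u, v) \<in> M S \<Longrightarrow> D u v < \<Delta> \<and> \<sigma> \<le> rform A S (p v) - rform A S (p u)"
    and M_avg: "\<gamma> * real (card V) \<le> ravg A (\<lambda>S. real (card (M S)))"
    and B0: "\<And>S. 0 \<le> B S"
    and B: "\<And>S u v. u \<in> V \<Longrightarrow> v \<in> V \<Longrightarrow> rform A S (p v) - rform A S (p u) \<le> B S * sqrt (D u v)"
    and B_avg: "ravg A (\<lambda>S. (B S)\<^sup>2) \<le> r"
    and \<Delta>: "0 < \<Delta>" and \<sigma>: "0 \<le> \<sigma>" and n: "0 < card V"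
    and K: "4 * sqrt (2 * (real K * \<Delta>)) \<le> \<sigma> * \<gamma>"
  shows "real K * (\<sigma> * \<gamma> / 2) \<le> sqrt r * sqrt (real K * \<Delta>)"
proof -
  \<comment> \<open>Since \<open>D u u = 0 < \<Delta>\<close>, loops belong to \<open>E\<close>:
    walks may pause, which makes \<open>Y\<close> monotone in \<open>k\<close>.\<close>
  define E where "E = {(u, v). u \<in> V \<and> v \<in> V \<and> D u v < \<Delta>}"
  define R where "R k u = (E ^^ k) `` {u}" for k u
  define Y where "Y k u S = Max ((\<lambda>w. rform A S (\<lambda>i. p w i - p u i)) ` R k u)" for k u S
  define a where "a k u = ravg A (Y k u)" for k u
  define e where "e k u S = \<bar>Y k u S - a k u\<bar>" for k u S
  have R_sub: "R k u \<subseteq> V" and R_D: "w \<in> R k u \<Longrightarrow> D u w \<le> real k * \<Delta>" if "u \<in> V" for k u w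
  proof -
    have "w \<in> V \<and> D u w \<le> real k * \<Delta>" if "(u, w) \<in> E ^^ k" for w
      using that \<open>u \<in> V\<close>
    proof (induction k arbitrary: u)
      case 0
      then show ?case by (simp add: D_refl)
    next
      case (Suc k)
      then obtain v where v: "(u, v) \<in> E" "(v, w) \<in> E ^^ k"
        by (meson relpow_Suc_D2)
      then have "v \<in> V" "D u v < \<Delta>" by (auto simp: E_def)
      moreover have "w \<in> V" "D v w \<le> real k * \<Delta>" using Suc.IH[OF v(2)] \<open>v \<in> V\<close> by auto
      ultimately show ?case using D_tri[of u v w] Suc.prems by (simp add: algebra_simps)
    qed
    then show "R k u \<subseteq> V" "w \<in> R k u \<Longrightarrow> D u w \<le> real k * \<Delta>" by (auto simp: R_def)
  qed
  have R_refl: "u \<in> R k u" if "u \<in> V" for k u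
  proof (induction k)
    case (Suc k)
    have "(u, u) \<in> E" using that \<Delta> by (simp add: E_def D_refl)
    then show ?case using Suc by (auto simp: R_def)
  qed (simp add: R_def)
  have R_fin: "finite (R k u)" if "u \<in> V" for k u
    using R_sub[OF that] V by (rule finite_subset)
  have Y_step: "Y k v S + (rform A S (p v) - rform A S (p u)) \<le> Y (Suc k) u S"
    if uv: "u \<in> V" "v \<in> V" "D u v < \<Delta>" for k u v S
  proof -
    have "Y k v S \<in> (\<lambda>w. rform A S (\<lambda>i. p w i - p v i)) ` R k v"
      unfolding Y_def using R_fin[OF uv(2)] R_refl[OF uv(2)] by (intro Max_in) auto
    then obtain w where w: "w \<in> R k v" "Y k v S = rform A S (\<lambda>i. p w i - p v i)" by auto
    have "(u, v) \<in> E" using uv by (simp add: E_def)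
    then have "w \<in> R (Suc k) u" using w(1) relpow_Suc_I2[of u v E w k] by (simp add: R_def)
    then have "rform A S (\<lambda>i. p w i - p u i) \<le> Y (Suc k) u S"
      unfolding Y_def using R_fin[OF uv(1)] by (intro Max_ge) auto
    then show ?thesis by (simp add: w(2) rform_diff)
  qed
  have Y_mono: "Y k u S \<le> Y (Suc k) u S" if "u \<in> V" for k u S
    using Y_step[OF that that, of k S] \<Delta> by (simp add: D_refl)
  have Y_le: "Y k u S \<le> B S * sqrt (real k * \<Delta>)" if u: "u \<in> V" for k u S
  proof -
    have "rform A S (p w) - rform A S (p u) \<le> B S * sqrt (real k * \<Delta>)" if w: "w \<in> R k u" for w
    proof -
      have "w \<in> V" using R_sub[OF u] w by auto
      then have "rform A S (p w) - rform A S (p u) \<le> B S * sqrt (D u w)" by (rule B[OF u])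
      also have "\<dots> \<le> B S * sqrt (real k * \<Delta>)"
        using R_D[OF u w] B0 by (intro mult_left_mono) auto
      finally show ?thesis .
    qed
    then show ?thesis
      unfolding Y_def using R_fin[OF u] R_refl[OF u] by (subst Max_le_iff) (auto simp: rform_diff)
  qed
  have e_avg: "ravg A (e k u) \<le> sqrt (2 * (real k * \<Delta>))" if u: "u \<in> V" for k u
  proof (rule ravg_le_sqrt[OF A])
    have "(\<Sum>i\<in>A. (p w i - p u i)\<^sup>2) \<le> real k * \<Delta>" if w: "w \<in> R k u" for w
      using pD[OF _ u, of w] R_sub[OF u] R_D[OF u w] w D_sym[of u w] by force
    then have "ravg A (\<lambda>S. (Y k u S - ravg A (Y k u))\<^sup>2) \<le> 2 * (real k * \<Delta>)"
      unfolding Y_def using R_fin[OF u] R_refl[OF u] by (intro variance_Max_rform A) auto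
    then show "ravg A (\<lambda>S. (e k u S)\<^sup>2) \<le> 2 * (real k * \<Delta>)"
      by (simp add: e_def a_def)
  qed
  have step: "(\<Sum>u\<in>V. a k u) + \<sigma> * \<gamma> * real (card V)
      - 2 * real (card V) * sqrt (2 * (real k * \<Delta>)) \<le> (\<Sum>u\<in>V. a (Suc k) u)" for k
  proof -
    define F where "F S w = Y (Suc k) w S + Y (Suc k) w (A - S)" for S w
    \<comment> \<open>The deviations are doubled because a matched vertex is bounded below through
      only one of the two sign vectors, used twice.\<close>
    define G where "G S w = 2 * a k w - 2 * e k w S - 2 * e k w (A - S)" for S w
    have sums: "(\<Sum>w\<in>V. G S w) + 2 * \<sigma> * real (card (M S)) \<le> (\<Sum>w\<in>V. F S w)" for S
    proof -
      let ?U = "V - (fst ` M S \<union> snd ` M S)"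
      have e_nonneg: "0 \<le> e k w T" for w T by (simp add: e_def)
      have ae: "a k w - e k w T \<le> Y k w T" for w T by (simp add: e_def)
      have "G S w \<le> F S w" if "w \<in> V" for w
        using Y_mono[OF that, of k S] Y_mono[OF that, of k "A - S"] ae[of w S] ae[of w "A - S"]
          e_nonneg[of w S] e_nonneg[of w "A - S"]
        unfolding F_def G_def by linarith
      then have 1: "(\<Sum>w\<in>?U. G S w) \<le> (\<Sum>w\<in>?U. F S w)"
        by (intro sum_mono) auto
      have "G S (fst x) + G S (snd x) + 2 * \<sigma> \<le> F S (fst x) + F S (snd x)" if x: "x \<in> M S" for x
      proof -
        obtain u v where uv: "x = (u, v)" by force
        have in_V: "u \<in> V" "v \<in> V" using M(1)[of S] x uv by auto
        have edge: "D u v < \<Delta>" "D v u < \<Delta>" "\<sigma> \<le> rform A S (p v) - rform A S (p u)"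
          using M_edge[of u v S] x uv D_sym[of v u] by auto
        have "Y k v S + \<sigma> \<le> Y (Suc k) u S"
          using Y_step[OF in_V edge(1), of k S] edge(3) by linarith
        moreover have "Y k u (A - S) + \<sigma> \<le> Y (Suc k) v (A - S)"
          using Y_step[OF in_V(2,1) edge(2), of k "A - S"] edge(3) by (simp add: rform_compl)
        moreover have "Y k u (A - S) \<le> Y (Suc k) u (A - S)" "Y k v S \<le> Y (Suc k) v S"
          using Y_mono in_V by auto
        ultimately show ?thesis
          using ae[of v S] ae[of u "A - S"] e_nonneg[of u S] e_nonneg[of v "A - S"] uv
          unfolding F_def G_def by simp
      qed
      then have "(\<Sum>x\<in>M S. G S (fst x) + G S (snd x) + 2 * \<sigma>)
          \<le> (\<Sum>x\<in>M S. F S (fst x) + F S (snd x))"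
        by (rule sum_mono)
      then have 2: "(\<Sum>x\<in>M S. G S (fst x) + G S (snd x)) + 2 * \<sigma> * real (card (M S))
          \<le> (\<Sum>x\<in>M S. F S (fst x) + F S (snd x))"
        by (simp add: sum.distrib mult_ac)
      show ?thesis
        using 1 2 sum_matching[OF V M(1-4), of "G S" S] sum_matching[OF V M(1-4), of "F S" S]
        by linarith
    qed
    have G_avg: "ravg A (\<lambda>S. G S w) = 2 * a k w - 4 * ravg A (e k w)" for w
      using ravg_compl[of A "e k w"] A unfolding G_def
      by (simp add: ravg_diff ravg_cmult ravg_add)
    have F_avg: "ravg A (\<lambda>S. F S w) = 2 * a (Suc k) w" for w
      using ravg_compl[of A "Y (Suc k) w"] A unfolding F_def a_def by (simp add: ravg_add)
    have "ravg A (\<lambda>S. (\<Sum>w\<in>V. G S w) + 2 * \<sigma> * real (card (M S)))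
        \<le> ravg A (\<lambda>S. \<Sum>w\<in>V. F S w)"
      using sums by (intro ravg_mono)
    then have "(\<Sum>w\<in>V. 2 * a k w - 4 * ravg A (e k w))
        + 2 * \<sigma> * ravg A (\<lambda>S. real (card (M S))) \<le> (\<Sum>w\<in>V. 2 * a (Suc k) w)"
      by (simp add: ravg_add ravg_cmult ravg_sum G_avg F_avg)
    moreover have "2 * \<sigma> * (\<gamma> * real (card V)) \<le> 2 * \<sigma> * ravg A (\<lambda>S. real (card (M S)))"
      using \<sigma> M_avg by (intro mult_left_mono) auto
    moreover have "(\<Sum>w\<in>V. ravg A (e k w)) \<le> real (card V) * sqrt (2 * (real k * \<Delta>))"
      using e_avg by (intro sum_bounded_above)
    ultimately show ?thesis
      by (simp add: sum_subtractf sum_distrib_left [symmetric])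
  qed
  have grow: "real k * (\<sigma> * \<gamma> / 2) * real (card V) \<le> (\<Sum>u\<in>V. a k u)" if "k \<le> K" for k
    using that
  proof (induction k)
    case 0
    have "Y 0 u = (\<lambda>_. 0)" for u by (rule ext) (simp add: Y_def R_def rform_def)
    then have "a 0 u = 0" for u using A by (simp add: a_def)
    then show ?case by simp
  next
    case (Suc k)
    \<comment> \<open>The hypothesis on \<open>K\<close> caps the deviation at
      \<open>\<sigma> * \<gamma> / 4\<close>; entering twice, it consumes half of the gain
      \<open>\<sigma> * \<gamma>\<close> of a step.\<close>
    have "sqrt (2 * (real k * \<Delta>)) \<le> sqrt (2 * (real K * \<Delta>))"
      using Suc.prems \<Delta> by (intro real_sqrt_le_mono mult_left_mono mult_right_mono) auto
    then have "sqrt (2 * (real k * \<Delta>)) \<le> \<sigma> * \<gamma> / 4" using K by linarith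
    then have "2 * real (card V) * sqrt (2 * (real k * \<Delta>)) \<le> 2 * real (card V) * (\<sigma> * \<gamma> / 4)"
      by (intro mult_left_mono) auto
    then show ?case using step[of k] Suc by (simp add: algebra_simps)
  qed
  have "a K u \<le> sqrt r * sqrt (real K * \<Delta>)" if "u \<in> V" for u
  proof -
    have "a K u \<le> ravg A (\<lambda>S. sqrt (real K * \<Delta>) * B S)"
      unfolding a_def using Y_le[OF that] by (intro ravg_mono) (simp add: mult.commute)
    also have "\<dots> \<le> sqrt (real K * \<Delta>) * sqrt r"
      unfolding ravg_cmult using \<Delta> ravg_le_sqrt[OF A B_avg] by (intro mult_left_mono) auto
    finally show ?thesis by (simp add: mult.commute)
  qed
  then have "(\<Sum>u\<in>V. a K u) \<le> real (card V) * (sqrt r * sqrt (real K * \<Delta>))"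
    by (intro sum_bounded_above)
  then have "real (card V) * (real K * (\<sigma> * \<gamma> / 2)) \<le> real (card V) * (sqrt r * sqrt (real K * \<Delta>))"
    using grow[of K] by (simp add: algebra_simps)
  then show ?thesis using n by simp
qed

section \<open>Separated sets from the spread of the projected points\<close>

text \<open>Expanding around \<open>c\<close> gives equality up to the dropped term
  \<open>- 2 * (\<Sum>x\<in>V. g x)^2\<close>.\<close>

lemma sum_pairwise_square_le:
  fixes f :: "'a \<Rightarrow> real"
  assumes "finite V"
  shows "(\<Sum>x\<in>V. \<Sum>y\<in>V. (f x - f y)\<^sup>2) \<le> 2 * real (card V) * (\<Sum>x\<in>V. (f x - c)\<^sup>2)"
proof -
  define g where "g x = f x - c" for x
  have "(\<Sum>x\<in>V. \<Sum>y\<in>V. (f x - f y)\<^sup>2) = (\<Sum>x\<in>V. \<Sum>y\<in>V. (g x)\<^sup>2 + (g y)\<^sup>2 - 2 * (g x * g y))"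
    by (intro sum.cong refl) (simp add: g_def power2_eq_square algebra_simps)
  also have "\<dots> = 2 * real (card V) * (\<Sum>x\<in>V. (g x)\<^sup>2) - 2 * (\<Sum>x\<in>V. g x)\<^sup>2"
    by (simp add: sum.distrib sum_subtractf power2_eq_square sum_product
        flip: sum_distrib_left)
  also have "\<dots> \<le> 2 * real (card V) * (\<Sum>x\<in>V. (g x)\<^sup>2)" by simp
  finally show ?thesis by (simp add: g_def)
qed

lemma sum_pairwise_sqdist_le:
  fixes p :: "'a \<Rightarrow> 'i \<Rightarrow> real"
  assumes "finite V"
  shows "(\<Sum>x\<in>V. \<Sum>y\<in>V. \<Sum>i\<in>A. (p x i - p y i)\<^sup>2)
    \<le> 2 * real (card V) * (\<Sum>x\<in>V. \<Sum>i\<in>A. (p x i - c i)\<^sup>2)"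
proof -
  have "(\<Sum>x\<in>V. \<Sum>y\<in>V. \<Sum>i\<in>A. (p x i - p y i)\<^sup>2) = (\<Sum>i\<in>A. \<Sum>x\<in>V. \<Sum>y\<in>V. (p x i - p y i)\<^sup>2)"
    by (simp only: sum.swap[of _ A])
  also have "\<dots> \<le> (\<Sum>i\<in>A. 2 * real (card V) * (\<Sum>x\<in>V. (p x i - c i)\<^sup>2))"
    by (intro sum_mono sum_pairwise_square_le assms)
  also have "\<dots> = 2 * real (card V) * (\<Sum>x\<in>V. \<Sum>i\<in>A. (p x i - c i)\<^sup>2)"
    by (simp add: sum.swap[of _ A] flip: sum_distrib_left)
  finally show ?thesis .
qed

text \<open>If \<open>Y\<close> were smaller, the mean of \<open>q u z\<close> would be below
  \<open>\<mu> / 4 + 4 * \<mu> / 32\<close>, and using \<open>z\<close> as centre would keep the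
  spread below \<open>\<mu>\<close>. Separation uses the relaxed triangle inequality with factor 2,
  valid for any squared Euclidean distance:
  \<open>\<mu> / 4 < 2 * q u v + \<mu> / 8\<close>.\<close>

lemma dense_ball_separated:
  fixes V :: "'a set" and A :: "'i set" and p :: "'a \<Rightarrow> 'i \<Rightarrow> real" and \<mu> :: real
  defines "q \<equiv> \<lambda>u v. \<Sum>i\<in>A. (p u i - p v i)\<^sup>2"
  assumes V: "finite V" "V \<noteq> {}" and \<mu>: "0 < \<mu>"
    and q4: "\<And>u v. u \<in> V \<Longrightarrow> v \<in> V \<Longrightarrow> q u v \<le> 4"
    and spread: "\<mu> * (real (card V))\<^sup>2 \<le> (\<Sum>u\<in>V. \<Sum>v\<in>V. q u v)"
    and z: "z \<in> V"
  defines "X \<equiv> {u\<in>V. q u z \<le> \<mu> / 16}" and "Y \<equiv> {u\<in>V. \<mu> / 4 < q u z}"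
  shows "\<mu> / 32 * real (card V) \<le> real (card Y)"
    and "\<And>u v. u \<in> X \<Longrightarrow> v \<in> Y \<Longrightarrow> \<mu> / 16 \<le> q u v"
proof -
  have n: "0 < real (card V)" using V by (simp add: card_gt_0_iff)
  show "\<mu> / 32 * real (card V) \<le> real (card Y)"
  proof (rule ccontr)
    assume *: "\<not> ?thesis"
    have "(\<Sum>u\<in>V. \<Sum>v\<in>V. q u v) \<le> 2 * real (card V) * (\<Sum>u\<in>V. q u z)"
      unfolding q_def by (rule sum_pairwise_sqdist_le[OF V(1)])
    also have "\<dots> \<le> 2 * real (card V) * (\<Sum>u\<in>V. \<mu> / 4 + 4 * of_bool (u \<in> Y))"
      using q4[OF _ z] \<mu> by (intro mult_left_mono sum_mono) (auto simp: Y_def not_less add_increasing)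
    also have "\<dots> = 2 * real (card V) * (real (card V) * (\<mu> / 4) + 4 * (\<Sum>u\<in>V. of_bool (u \<in> Y)))"
      by (simp add: sum.distrib flip: sum_distrib_left)
    also have "(\<Sum>u\<in>V. of_bool (u \<in> Y)) = (\<Sum>u\<in>Y. 1 :: real)"
      using V by (intro sum.mono_neutral_cong_right) (auto simp: Y_def)
    also have "2 * real (card V) * (real (card V) * (\<mu> / 4) + 4 * (\<Sum>u\<in>Y. 1))
        < 2 * real (card V) * (real (card V) * (\<mu> / 4) + 4 * (\<mu> / 32 * real (card V)))"
      using * n by (intro mult_strict_left_mono) auto
    also have "\<dots> = 3 / 4 * (\<mu> * (real (card V))\<^sup>2)"
      by (simp add: power2_eq_square field_simps)
    also have "\<dots> \<le> \<mu> * (real (card V))\<^sup>2" using \<mu> by simp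
    finally show False using spread by simp
  qed
  show "\<mu> / 16 \<le> q u v" if "u \<in> X" "v \<in> Y" for u v
  proof -
    have "q v z \<le> (\<Sum>i\<in>A. 2 * (p u i - p v i)\<^sup>2 + 2 * (p u i - p z i)\<^sup>2)"
      unfolding q_def
    proof (intro sum_mono)
      fix i
      show "(p v i - p z i)\<^sup>2 \<le> 2 * (p u i - p v i)\<^sup>2 + 2 * (p u i - p z i)\<^sup>2"
        using zero_le_power2[of "2 * p u i - p v i - p z i"]
        by (simp add: power2_eq_square algebra_simps)
    qed
    also have "\<dots> = 2 * q u v + 2 * q u z"
      by (simp add: q_def sum.distrib sum_distrib_left)
    finally show ?thesis using that by (auto simp: X_def Y_def)
  qed
qed

text \<open>Double counting: each point is far from at least \<open>15 / 16\<close> of all points,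
  and a far pair is separated with probability at least \<open>63 / 200\<close>. Subtracting the
  loss \<open>4 * m\<close> leaves \<open>4 * ravg A c\<close> at least
  \<open>(945 / 3200 - 1 / 4) * card V\<close>.\<close>

lemma expected_matching_size:
  fixes V :: "'a set" and A :: "'i set" and p :: "'a \<Rightarrow> 'i \<Rightarrow> real" and c :: "'i set \<Rightarrow> real"
  assumes V: "finite V" "V \<noteq> {}" and A: "finite A" and \<sigma>: "0 \<le> \<sigma>"
    and m: "m \<le> real (card V) / 16"
    and sparse: "\<And>u. u \<in> V \<Longrightarrow> real (card {v\<in>V. (\<Sum>i\<in>A. (p u i - p v i)\<^sup>2) < 25 * \<sigma>\<^sup>2}) \<le> m"
    and count: "\<And>S. (\<Sum>x\<in>V. \<Sum>y\<in>V. of_bool (\<sigma> \<le> \<bar>rform A S (p x) - rform A S (p y)\<bar>))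
      \<le> 4 * real (card V) * (m + c S)"
  shows "1 / 100 * real (card V) \<le> ravg A c"
proof -
  let ?n = "real (card V)"
  let ?q = "\<lambda>u v. \<Sum>i\<in>A. (p u i - p v i)\<^sup>2"
  have n: "0 < ?n" using V by (simp add: card_gt_0_iff)
  have row: "15 / 16 * ?n \<le> (\<Sum>y\<in>V. of_bool (25 * \<sigma>\<^sup>2 \<le> ?q x y))" if "x \<in> V" for x
  proof -
    let ?C = "{v\<in>V. ?q x v < 25 * \<sigma>\<^sup>2}"
    have "(\<Sum>y\<in>V. of_bool (25 * \<sigma>\<^sup>2 \<le> ?q x y)) = (\<Sum>y\<in>V - ?C. 1 :: real)"
      using V by (intro sum.mono_neutral_cong_right) (auto simp: not_le)
    also have "\<dots> = ?n - real (card ?C)"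
      using V by (simp add: card_Diff_subset card_mono of_nat_diff)
    finally show ?thesis using sparse[OF that] m by linarith
  qed
  have pair: "63 / 200 * of_bool (25 * \<sigma>\<^sup>2 \<le> ?q x y)
      \<le> ravg A (\<lambda>S. of_bool (\<sigma> \<le> \<bar>rform A S (p x) - rform A S (p y)\<bar>))" for x y
  proof (cases "25 * \<sigma>\<^sup>2 \<le> ?q x y")
    case True
    have "63 / 200 \<le> ravg A (\<lambda>S. of_bool (?q x y \<le> 25 * (rform A S (\<lambda>i. p x i - p y i))\<^sup>2))"
      by (rule rform_anticoncentration[OF A])
    also have "\<dots> \<le> ravg A (\<lambda>S. of_bool (\<sigma> \<le> \<bar>rform A S (p x) - rform A S (p y)\<bar>))"
    proof (intro ravg_mono)
      fix S
      have "\<sigma> \<le> \<bar>rform A S (p x) - rform A S (p y)\<bar>"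
        if "?q x y \<le> 25 * (rform A S (\<lambda>i. p x i - p y i))\<^sup>2"
      proof -
        have "\<sigma>\<^sup>2 \<le> (rform A S (p x) - rform A S (p y))\<^sup>2"
          using that True unfolding rform_diff by linarith
        then show ?thesis using \<sigma> by (simp add: abs_le_square_iff[symmetric])
      qed
      then show "(of_bool (?q x y \<le> 25 * (rform A S (\<lambda>i. p x i - p y i))\<^sup>2) :: real)
          \<le> of_bool (\<sigma> \<le> \<bar>rform A S (p x) - rform A S (p y)\<bar>)"
        by simp
    qed
    finally show ?thesis using True by simp
  qed (simp add: ravg_def sum_nonneg)
  have "?n * (63 / 200 * (15 / 16 * ?n)) = (\<Sum>x\<in>V. 63 / 200 * (15 / 16 * ?n))" by simp
  also have "\<dots> \<le> (\<Sum>x\<in>V. 63 / 200 * (\<Sum>y\<in>V. of_bool (25 * \<sigma>\<^sup>2 \<le> ?q x y)))"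
    by (intro sum_mono mult_left_mono row) auto
  also have "\<dots> \<le> (\<Sum>x\<in>V. \<Sum>y\<in>V. ravg A (\<lambda>S. of_bool (\<sigma> \<le> \<bar>rform A S (p x) - rform A S (p y)\<bar>)))"
    unfolding sum_distrib_left by (intro sum_mono pair)
  also have "\<dots> \<le> ravg A (\<lambda>S. 4 * ?n * (m + c S))"
    unfolding ravg_sum [symmetric] by (intro ravg_mono count)
  also have "\<dots> = ?n * (4 * (m + ravg A c))"
    using A by (simp add: ravg_add ravg_cmult)
  finally have "63 / 200 * (15 / 16 * ?n) \<le> 4 * (m + ravg A c)" using n by simp
  then have "945 / 3200 * ?n \<le> 4 * m + 4 * ravg A c" by simp
  then show ?thesis using m by linarith
qed

text \<open>The core without matrices: \<open>D\<close> is the squared distance of the original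
  points, \<open>p\<close> holds the projected coordinates, and \<open>B S\<close> bounds the length
  of the projected sign vector.\<close>

lemma separated_sets_exist:
  fixes V :: "'a set" and A :: "'i set" and p :: "'a \<Rightarrow> 'i \<Rightarrow> real" and D :: "'a \<Rightarrow> 'a \<Rightarrow> real"
  assumes V: "finite V" "V \<noteq> {}" and A: "finite A"
    and D_refl: "\<And>u. D u u = 0" and D_sym: "\<And>u v. D u v = D v u"
    and D_tri: "\<And>u v w. u \<in> V \<Longrightarrow> v \<in> V \<Longrightarrow> w \<in> V \<Longrightarrow> D u w \<le> D u v + D v w"
    and D4: "\<And>u v. u \<in> V \<Longrightarrow> v \<in> V \<Longrightarrow> D u v \<le> 4"
    and pD: "\<And>u v. u \<in> V \<Longrightarrow> v \<in> V \<Longrightarrow> (\<Sum>i\<in>A. (p u i - p v i)\<^sup>2) \<le> D u v"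
    and B0: "\<And>S. 0 \<le> B S"
    and B: "\<And>S u v. u \<in> V \<Longrightarrow> v \<in> V \<Longrightarrow> rform A S (p v) - rform A S (p u) \<le> B S * sqrt (D u v)"
    and B_avg: "ravg A (\<lambda>S. (B S)\<^sup>2) \<le> r" and r: "1 \<le> r"
    and \<mu>: "0 < \<mu>" "\<mu> \<le> 2"
    and spread: "\<mu> * (real (card V))\<^sup>2 \<le> (\<Sum>u\<in>V. \<Sum>v\<in>V. \<Sum>i\<in>A. (p u i - p v i)\<^sup>2)"
  shows "\<exists>X Y. X \<subseteq> V \<and> Y \<subseteq> V \<and> \<mu> / 32 * real (card V) \<le> real (card X)
    \<and> \<mu> / 32 * real (card V) \<le> real (card Y) \<and> (\<forall>u\<in>X. \<forall>v\<in>Y. \<mu> / 128000000 / sqrt r \<le> D u v)"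
proof (rule ccontr)
  assume no: "\<not> ?thesis"
  \<comment> \<open>The constant is \<open>32 * 4000000\<close>: chaining needs
    \<open>32 * (K * \<Delta>)\<close> to be at most \<open>(\<sigma> / 100)^2\<close>, which equals
    \<open>\<mu> / 4000000\<close>.\<close>
  define \<Delta> where "\<Delta> = \<mu> / 128000000 / sqrt r"
  define m where "m = \<mu> / 32 * real (card V)"
  \<comment> \<open>Chosen so that the anticoncentration radius \<open>25 * \<sigma>^2\<close> is
    the ball radius \<open>\<mu> / 16\<close> of \<open>dense_ball_separated\<close>.\<close>
  define \<sigma> where "\<sigma> = sqrt \<mu> / 20"
  let ?q = "\<lambda>u v. \<Sum>i\<in>A. (p u i - p v i)\<^sup>2"
  have nosep: "\<exists>u\<in>X. \<exists>v\<in>Y. D u v < \<Delta>"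
    if "X \<subseteq> V" "Y \<subseteq> V" "m \<le> real (card X)" "m \<le> real (card Y)" for X Y
  proof (rule ccontr)
    assume "\<not> ?thesis"
    then have "\<forall>u\<in>X. \<forall>v\<in>Y. \<Delta> \<le> D u v" by (auto simp: not_less)
    then show False using no that unfolding \<Delta>_def m_def by blast
  qed
  have n: "0 < card V" using V by (simp add: card_gt_0_iff)
  have m: "0 < m" "m \<le> real (card V) / 16"
    using \<mu> n by (auto simp: m_def field_simps)
  have \<sigma>: "0 < \<sigma>" "25 * \<sigma>\<^sup>2 = \<mu> / 16" using \<mu> by (auto simp: \<sigma>_def power_divide)
  have sqr: "1 \<le> sqrt r" using r by simp
  have \<Delta>: "0 < \<Delta>" "\<Delta> \<le> \<mu> / 16"
  proof -
    show "0 < \<Delta>" using \<mu> sqr by (simp add: \<Delta>_def)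
    have "\<Delta> \<le> \<mu> / 128000000 / 1"
      unfolding \<Delta>_def using sqr \<mu> by (intro divide_left_mono) auto
    then show "\<Delta> \<le> \<mu> / 16" using \<mu> by simp
  qed
  \<comment> \<open>A dense ball would yield two large sets at distance at least
    \<open>\<mu> / 16\<close>, hence at least \<open>\<Delta>\<close>, against
    \<open>nosep\<close>.\<close>
  have sparse: "real (card {v\<in>V. ?q u v < 25 * \<sigma>\<^sup>2}) \<le> m" if u: "u \<in> V" for u
  proof (rule ccontr)
    let ?X = "{v\<in>V. ?q v u \<le> \<mu> / 16}" and ?Y = "{v\<in>V. \<mu> / 4 < ?q v u}"
    assume "\<not> ?thesis"
    moreover have "card {v\<in>V. ?q u v < 25 * \<sigma>\<^sup>2} \<le> card ?X"
      using V by (intro card_mono) (auto simp: \<sigma>(2) power2_commute[of "p u _"])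
    ultimately have X: "m \<le> real (card ?X)" by linarith
    have q4: "?q v w \<le> 4" if "v \<in> V" "w \<in> V" for v w
      using pD[OF that] D4[OF that] by linarith
    have Y: "m \<le> real (card ?Y)"
      unfolding m_def by (rule dense_ball_separated(1)[OF V \<mu>(1) q4 spread u])
    obtain v w where vw: "v \<in> ?X" "w \<in> ?Y" "D v w < \<Delta>"
      using nosep[OF _ _ X Y] by blast
    have "\<mu> / 16 \<le> ?q v w"
      by (rule dense_ball_separated(2)[OF V \<mu>(1) q4 spread u vw(1,2)])
    moreover have "?q v w \<le> D v w" using vw by (intro pD) auto
    ultimately show False using vw(3) \<Delta>(2) by linarith
  qed
  have "\<exists>M. M \<subseteq> V \<times> V \<and> inj_on fst M \<and> inj_on snd M \<and> fst ` M \<inter> snd ` M = {}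
      \<and> (\<forall>u v. (u, v) \<in> M \<longrightarrow> D u v < \<Delta> \<and> \<sigma> \<le> rform A S (p v) - rform A S (p u))
      \<and> (\<Sum>x\<in>V. \<Sum>y\<in>V. of_bool (\<sigma> \<le> \<bar>rform A S (p x) - rform A S (p y)\<bar>))
        \<le> 4 * real (card V) * (m + real (card M))" (is "\<exists>M. ?P S M") for S
    by (rule large_matching[OF V(1) m(1) \<sigma>(1) nosep, of "\<lambda>x. rform A S (p x)"]) blast+
  then obtain M where M: "\<And>S. ?P S (M S)" by metis
  have M_avg: "1 / 100 * real (card V) \<le> ravg A (\<lambda>S. real (card (M S)))"
    using M \<sigma>(1) by (intro expected_matching_size[OF V A _ m(2) sparse]) auto
  \<comment> \<open>With about \<open>sqrt r\<close> steps, \<open>K * \<Delta>\<close> is bounded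
    independently of \<open>r\<close>.\<close>
  define K where "K = nat \<lfloor>sqrt r\<rfloor>"
  have K: "real K \<le> sqrt r" "sqrt r / 2 \<le> real K" "0 < real K"
  proof -
    have "real K = of_int \<lfloor>sqrt r\<rfloor>" "1 \<le> \<lfloor>sqrt r\<rfloor>"
      using sqr by (auto simp: K_def le_floor_iff)
    then show "real K \<le> sqrt r" "sqrt r / 2 \<le> real K" "0 < real K" by linarith+
  qed
  have K\<Delta>: "real K * \<Delta> \<le> \<mu> / 128000000"
  proof -
    have "real K * \<Delta> \<le> sqrt r * \<Delta>" using K \<Delta> by (intro mult_right_mono) auto
    then show ?thesis using sqr by (simp add: \<Delta>_def)
  qed
  have "4 * sqrt (2 * (real K * \<Delta>)) \<le> \<sigma> * (1 / 100)"
  proof (rule power2_le_imp_le)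
    have "0 \<le> real K * \<Delta>" using \<Delta> by simp
    then show "(4 * sqrt (2 * (real K * \<Delta>)))\<^sup>2 \<le> (\<sigma> * (1 / 100))\<^sup>2"
      using K\<Delta> \<sigma>(2) by (simp add: power_mult_distrib power_divide)
  qed (use \<sigma> in simp)
  then have "real K * (\<sigma> * (1 / 100) / 2) \<le> sqrt r * sqrt (real K * \<Delta>)"
    using M \<sigma>(1)
    by (intro chaining_bound[OF V(1) A D_refl D_sym D_tri pD _ _ _ _ _ M_avg B0 B B_avg \<Delta>(1) _ n]) auto
  then have "(real K * (\<sigma> * (1 / 100) / 2))\<^sup>2 \<le> (sqrt r * sqrt (real K * \<Delta>))\<^sup>2"
    using \<sigma>(1) by (intro power_mono) auto
  then have "real K * (real K * (\<sigma>\<^sup>2 / 40000)) \<le> real K * (r * \<Delta>)"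
    using r \<Delta> by (simp add: power_mult_distrib power_divide power2_eq_square[of "real K"] mult_ac)
  then have "real K * (\<sigma>\<^sup>2 / 40000) \<le> r * \<Delta>" using K(3) by simp
  moreover have "\<sigma>\<^sup>2 / 40000 = \<mu> / 16000000" using \<sigma>(2) by simp
  ultimately have "real K * (\<mu> / 16000000) \<le> r * \<Delta>" by simp
  also have "\<dots> = sqrt r * (\<mu> / 128000000)"
    using r by (simp add: \<Delta>_def real_div_sqrt field_simps)
  finally have "real K / 16000000 \<le> sqrt r / 128000000" using \<mu>(1) by simp
  \<comment> \<open>The chaining bound forces \<open>K\<close> below \<open>sqrt r / 8\<close>, but
    rounding down lost at most a factor 2.\<close>
  then show False using K(2) sqr by linarith
qed

section \<open>Trace and rank of an idempotent matrix\<close>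

text \<open>Ties the rank to a concrete basis of the column space: a column outside the span would
  enlarge a maximal independent set.\<close>

lemma (in vec_space) indpt_cols_span:
  assumes M: "M \<in> carrier_mat n nc"
  obtains U where "U \<subseteq> set (cols M)" "lin_indpt U" "card U = rank M" "set (cols M) \<subseteq> span U"
proof -
  let ?Q = "\<lambda>T. T \<subseteq> set (cols M) \<and> lin_indpt T"
  have "lin_indpt {}" by (simp add: finite_lin_indpt2)
  then obtain U where max: "maximal U ?Q"
    using maximal_exists_superset[of "set (cols M)" ?Q "{}"] by auto
  then have U: "U \<subseteq> set (cols M)" "lin_indpt U" by (auto simp: maximal_def)
  have car: "set (cols M) \<subseteq> carrier_vec n" using cols_dim M by blast
  then have Uc: "U \<subseteq> carrier_vec n" using U(1) by auto
  have "v \<in> span U" if v: "v \<in> set (cols M)" for v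
  proof (cases "v \<in> U")
    case True
    then show ?thesis using span_mem[OF Uc] by auto
  next
    case False
    show ?thesis
    proof (rule ccontr)
      assume "v \<notin> span U"
      then have "lin_indpt (U \<union> {v})"
        using lin_dep_iff_in_span[OF Uc U(2) _ False] v car by auto
      then have "?Q (U \<union> {v})" using U(1) v by auto
      then have "U \<union> {v} = U" using max unfolding maximal_def by blast
      then show False using False by auto
    qed
  qed
  then show ?thesis using that[OF U rank_card_indpt[OF M max, symmetric]] by auto
qed

lemma (in vec_space) lin_indpt_coeffs:
  assumes U: "finite U" "U \<subseteq> carrier_vec n" and ind: "lin_indpt U"
    and zero: "\<And>k. k < n \<Longrightarrow> (\<Sum>v\<in>U. b v * v $ k) = 0" and v: "v \<in> U"
  shows "b v = 0"
proof (rule ccontr)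
  assume "b v \<noteq> 0"
  have "lincomb b U = 0\<^sub>v n"
    using zero lincomb_index[OF _ U(2)] lincomb_dim[OF U] by (intro eq_vecI) auto
  then have "lin_dep U"
    using U v \<open>b v \<noteq> 0\<close> by (intro lin_dep_crit[where A = U and S = U and a = b and v = v]) auto
  then show False using ind by simp
qed

text \<open>The columns of \<open>P\<close> are expanded in a basis \<open>U\<close> of the column space; since \<open>P\<close> fixes \<open>U\<close>, the
  coefficient functionals form the dual basis, and the trace becomes \<open>card U\<close>.\<close>

lemma idempotent_trace_eq_rank:
  fixes P :: "real mat"
  assumes P: "P \<in> carrier_mat d d" "P * P = P"
  shows "(\<Sum>k<d. P $$ (k, k)) = real (vec_space.rank d P)"
proof -
  interpret vec_space "TYPE(real)" d .
  obtain U where U: "U \<subseteq> set (cols P)" "lin_indpt U" "card U = rank P" "set (cols P) \<subseteq> span U"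
    by (rule indpt_cols_span[OF P(1)])
  have fin: "finite U" using U(1) by (rule finite_subset) simp
  have car: "U \<subseteq> carrier_vec d" using U(1) cols_dim[of P] P(1) by auto
  have "\<exists>c. \<forall>k<d. P $$ (k, j) = (\<Sum>u\<in>U. c u * u $ k)" if j: "j < d" for j
  proof -
    have "col P j \<in> span U" using U(4) j P(1) by (auto simp: cols_def)
    then obtain c where c: "lincomb c U = col P j" using finite_in_span[OF fin car] by auto
    have "P $$ (k, j) = (\<Sum>u\<in>U. c u * u $ k)" if "k < d" for k
      using lincomb_index[OF that car, of c] c P(1) j that by simp
    then show ?thesis by blast
  qed
  then obtain c where c: "\<And>k j. k < d \<Longrightarrow> j < d \<Longrightarrow> P $$ (k, j) = (\<Sum>u\<in>U. c j u * u $ k)"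
    by metis
  have fixed: "(\<Sum>j<d. P $$ (k, j) * u $ j) = u $ k" if u: "u \<in> U" and k: "k < d" for u k
  proof -
    obtain i where i: "i < d" "u = col P i" using u U(1) P(1) by (auto simp: cols_def)
    have "(\<Sum>j<d. P $$ (k, j) * u $ j) = (P * P) $$ (k, i)"
      using i k P(1) by (simp add: scalar_prod_def atLeast0LessThan)
    then show ?thesis using i k P by simp
  qed
  have dual: "(\<Sum>j<d. c j u * w $ j) = of_bool (u = w)" if u: "u \<in> U" and w: "w \<in> U" for u w
  proof -
    \<comment> \<open>The combination of \<open>U\<close> with coefficients \<open>b\<close> is
      \<open>P w - w\<close>, which vanishes; independence then forces every coefficient to be
      zero.\<close>
    define b where "b u = (\<Sum>j<d. c j u * w $ j) - of_bool (u = w)" for u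
    have "(\<Sum>u\<in>U. b u * u $ k) = 0" if k: "k < d" for k
    proof -
      have "(\<Sum>u\<in>U. (\<Sum>j<d. c j u * w $ j) * u $ k) = (\<Sum>j<d. (\<Sum>u\<in>U. c j u * u $ k) * w $ j)"
        unfolding sum_distrib_right by (subst sum.swap) (simp add: mult_ac)
      also have "\<dots> = (\<Sum>j<d. P $$ (k, j) * w $ j)"
        using c k by (intro sum.cong) auto
      also have "\<dots> = w $ k" by (rule fixed[OF w k])
      finally have "(\<Sum>u\<in>U. (\<Sum>j<d. c j u * w $ j) * u $ k) = w $ k" .
      moreover have "(\<Sum>u\<in>U. of_bool (u = w) * u $ k) = w $ k"
        using fin w by (subst sum.remove[of _ w]) (auto intro!: sum.neutral)
      ultimately show ?thesis by (simp add: b_def left_diff_distrib sum_subtractf)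
    qed
    then have "b u = 0" by (rule lin_indpt_coeffs[OF fin car U(2) _ u])
    then show ?thesis by (simp add: b_def)
  qed
  have "(\<Sum>k<d. P $$ (k, k)) = (\<Sum>k<d. \<Sum>u\<in>U. c k u * u $ k)"
    using c by (intro sum.cong) auto
  also have "\<dots> = (\<Sum>u\<in>U. \<Sum>k<d. c k u * u $ k)" by (rule sum.swap)
  also have "\<dots> = (\<Sum>u\<in>U. 1)" using dual by (intro sum.cong) auto
  finally show ?thesis using U(3) by simp
qed

section \<open>Projected sign vectors\<close>

lemma l2_norm_square: "(l2_norm v)\<^sup>2 = (\<Sum>i<dim_vec v. (v $ i)\<^sup>2)"
  by (simp add: l2_norm_def scalar_prod_def atLeast0LessThan power2_eq_square sum_nonneg)

lemma l2_norm_diff_square: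
  assumes "v \<in> carrier_vec d" "w \<in> carrier_vec d"
  shows "(l2_norm (v - w))\<^sup>2 = (\<Sum>i<d. (v $ i - w $ i)\<^sup>2)"
  using assms by (simp add: l2_norm_square)

text \<open>Symmetry and idempotence make the squared length of \<open>P w\<close> equal to the
  scalar product of \<open>w\<close> and \<open>P w\<close>, so the squared length of
  \<open>w - P w\<close> is the difference of the two sides.\<close>

lemma orthogonal_projector_contraction:
  assumes P: "orthogonal_projector d P" and w: "w \<in> carrier_vec d"
  shows "(l2_norm (P *\<^sub>v w))\<^sup>2 \<le> (l2_norm w)\<^sup>2"
proof -
  have P: "P \<in> carrier_mat d d" "P * P = P" "transpose_mat P = P"
    using P by (auto simp: orthogonal_projector_def)
  let ?u = "P *\<^sub>v w"
  have u: "?u \<in> carrier_vec d" using P(1) w by auto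
  have "?u \<bullet> ?u = w \<bullet> (P *\<^sub>v ?u)"
    using transpose_vec_mult_scalar[OF P(1) u w] P(3) by simp
  also have "P *\<^sub>v ?u = ?u"
    using assoc_mult_mat_vec[OF P(1) P(1) w] P(2) by simp
  finally have "(\<Sum>i<d. (?u $ i)\<^sup>2) = (\<Sum>i<d. w $ i * ?u $ i)"
    using P(1) w by (simp add: scalar_prod_def atLeast0LessThan power2_eq_square)
  then have "(\<Sum>i<d. (w $ i - ?u $ i)\<^sup>2) = (\<Sum>i<d. (w $ i)\<^sup>2) - (\<Sum>i<d. (?u $ i)\<^sup>2)"
    by (simp add: power2_diff sum.distrib sum_subtractf sum_distrib_left [symmetric] mult.assoc)
  moreover have "0 \<le> (\<Sum>i<d. (w $ i - ?u $ i)\<^sup>2)" by (simp add: sum_nonneg)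
  ultimately show ?thesis using P(1) w by (simp add: l2_norm_square)
qed

text \<open>Column \<open>k\<close> of a symmetric idempotent has squared length
  \<open>P $$ (k, k)\<close>, so the second moments add up to the trace.\<close>

lemma ravg_projected_sign_vector:
  assumes P: "orthogonal_projector d P"
  shows "ravg {..<d} (\<lambda>S. \<Sum>k<d. (rform {..<d} S (\<lambda>l. P $$ (l, k)))\<^sup>2)
    = real (vec_space.rank d P)"
proof -
  have P: "P \<in> carrier_mat d d" "P * P = P" "transpose_mat P = P"
    using P by (auto simp: orthogonal_projector_def)
  have "(\<Sum>l<d. (P $$ (l, k))\<^sup>2) = P $$ (k, k)" if k: "k < d" for k
  proof -
    have "P $$ (k, k) = (\<Sum>l<d. P $$ (k, l) * P $$ (l, k))"
      by (subst (1) P(2) [symmetric])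
        (use P(1) k in \<open>simp add: scalar_prod_def atLeast0LessThan\<close>)
    also have "\<dots> = (\<Sum>l<d. transpose_mat P $$ (k, l) * P $$ (l, k))" by (simp add: P(3))
    also have "\<dots> = (\<Sum>l<d. (P $$ (l, k))\<^sup>2)"
      using P(1) k by (intro sum.cong) (auto simp: power2_eq_square)
    finally show ?thesis by simp
  qed
  then show ?thesis
    using idempotent_trace_eq_rank[OF P(1,2)] by (simp add: ravg_sum ravg_rform_square)
qed

section \<open>Application to the projected point set\<close>

theorem theorem3p3:
  fixes \<eta> \<delta> :: real
  assumes "0 < \<eta>" and "\<eta> \<le> 1" and "0 < \<delta>"
  shows "\<exists>\<kappa>::real. \<kappa> > 0 \<and>
    (\<forall>(d::nat) (n::nat) (r::nat) (x :: nat \<Rightarrow> real vec).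
       (\<forall>i\<in>{1..n}. x i \<in> carrier_vec d \<and> l2_norm (x i) \<le> 1) \<longrightarrow>
       (\<forall>i\<in>{1..n}. \<forall>j\<in>{1..n}. \<forall>k\<in>{1..n}.
          (l2_norm (x i - x j))\<^sup>2 + (l2_norm (x j - x k))\<^sup>2 \<ge> (l2_norm (x i - x k))\<^sup>2) \<longrightarrow>
       ssr \<eta> d n x r \<longrightarrow>
       1 / (real n)\<^sup>2 * (\<Sum>i=1..n. \<Sum>j=1..n. (l2_norm (x i - x j))\<^sup>2) \<ge> \<delta> \<longrightarrow>
       (\<exists>A B. A \<subseteq> {1..n} \<and> B \<subseteq> {1..n} \<and>
          real (card A) \<ge> \<eta> * \<delta> / 32 * real n \<and>
          real (card B) \<ge> \<eta> * \<delta> / 32 * real n \<and>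
          (\<forall>i\<in>A. \<forall>j\<in>B. (l2_norm (x i - x j))\<^sup>2 \<ge> \<kappa> / sqrt (real r))))"
proof (intro exI[of _ "\<eta> * \<delta> / 128000000"] conjI allI impI)
  show "0 < \<eta> * \<delta> / 128000000" using assms by simp
next
  fix d n r :: nat and x :: "nat \<Rightarrow> real vec"
  assume x: "\<forall>i\<in>{1..n}. x i \<in> carrier_vec d \<and> l2_norm (x i) \<le> 1"
    and tri: "\<forall>i\<in>{1..n}. \<forall>j\<in>{1..n}. \<forall>k\<in>{1..n}.
      (l2_norm (x i - x j))\<^sup>2 + (l2_norm (x j - x k))\<^sup>2 \<ge> (l2_norm (x i - x k))\<^sup>2"
    and "ssr \<eta> d n x r"
    and avg: "1 / (real n)\<^sup>2 * (\<Sum>i=1..n. \<Sum>j=1..n. (l2_norm (x i - x j))\<^sup>2) \<ge> \<delta>"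
  then obtain P where P: "orthogonal_projector d P" "vec_space.rank d P = r"
    and rank: "(\<Sum>i=1..n. \<Sum>j=1..n. (l2_norm (P *\<^sub>v x i - P *\<^sub>v x j))\<^sup>2)
      \<ge> \<eta> * (\<Sum>i=1..n. \<Sum>j=1..n. (l2_norm (x i - x j))\<^sup>2)"
    unfolding ssr_def by blast
  have Pc: "P \<in> carrier_mat d d" using P by (simp add: orthogonal_projector_def)
  let ?V = "{1..n}"
  define D where "D u v = (\<Sum>i<d. (x u $ i - x v $ i)\<^sup>2)" for u v
  define p where "p u i = (P *\<^sub>v x u) $ i" for u i
  define B where "B S = L2_set (\<lambda>k. rform {..<d} S (\<lambda>l. P $$ (l, k))) {..<d}" for S
  \<comment> \<open>For \<open>n = 0\<close> division by zero makes the average 0, contradicting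
    \<open>0 < \<delta>\<close>.\<close>
  have n: "0 < n" using avg assms(3) by (cases "n = 0") auto
  have xc: "x u \<in> carrier_vec d" "(\<Sum>i<d. (x u $ i)\<^sup>2) \<le> 1" if "u \<in> ?V" for u
  proof -
    show c: "x u \<in> carrier_vec d" using x that by blast
    have "l2_norm (x u) \<le> 1" "0 \<le> l2_norm (x u)"
      using x that by (auto simp: l2_norm_def scalar_prod_def intro: sum_nonneg)
    then have "(l2_norm (x u))\<^sup>2 \<le> 1" by (simp add: power_le_one)
    then show "(\<Sum>i<d. (x u $ i)\<^sup>2) \<le> 1" using c by (simp add: l2_norm_square)
  qed
  have D: "(l2_norm (x u - x v))\<^sup>2 = D u v" if "u \<in> ?V" "v \<in> ?V" for u v
    unfolding D_def using xc that by (intro l2_norm_diff_square) auto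
  have q: "(l2_norm (P *\<^sub>v x u - P *\<^sub>v x v))\<^sup>2 = (\<Sum>i<d. (p u i - p v i)\<^sup>2)"
    if "u \<in> ?V" "v \<in> ?V" for u v
    unfolding p_def using xc[OF that(1)] xc[OF that(2)] Pc by (intro l2_norm_diff_square) auto
  have D_sum: "\<delta> * (real n)\<^sup>2 \<le> (\<Sum>u\<in>?V. \<Sum>v\<in>?V. D u v)"
    using avg n by (simp add: D field_simps)
  \<comment> \<open>Comparison with the origin in the unit ball gives
    \<open>\<delta> \<le> 2\<close>, hence the upper bound on
    \<open>\<mu> = \<eta> * \<delta>\<close>.\<close>
  have "(\<Sum>u\<in>?V. \<Sum>v\<in>?V. D u v) \<le> 2 * real (card ?V) * (\<Sum>u\<in>?V. \<Sum>i<d. (x u $ i - 0)\<^sup>2)"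
    unfolding D_def by (rule sum_pairwise_sqdist_le) simp
  also have "\<dots> \<le> 2 * real (card ?V) * (\<Sum>u\<in>?V. 1)"
    using xc by (intro mult_left_mono sum_mono) auto
  finally have "\<delta> * (real n)\<^sup>2 \<le> 2 * (real n)\<^sup>2"
    using D_sum by (simp add: power2_eq_square)
  then have "\<delta> \<le> 2" using n by simp
  then have \<mu>: "0 < \<eta> * \<delta>" "\<eta> * \<delta> \<le> 2"
    using assms mult_mono[of \<eta> 1 \<delta> 2] by auto
  have "\<exists>X Y. X \<subseteq> ?V \<and> Y \<subseteq> ?V \<and> \<eta> * \<delta> / 32 * real n \<le> real (card X)
    \<and> \<eta> * \<delta> / 32 * real n \<le> real (card Y)
    \<and> (\<forall>u\<in>X. \<forall>v\<in>Y. \<eta> * \<delta> / 128000000 / sqrt (real r) \<le> D u v)"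
  proof (cases "r = 0")
    case True
    \<comment> \<open>For \<open>r = 0\<close> division by \<open>sqrt 0\<close> gives 0, so the
      required separation is 0 and the whole index set serves as both sets.\<close>
    have "\<eta> * \<delta> / 32 * real n \<le> 1 * real n"
      using \<mu> by (intro mult_right_mono) auto
    then show ?thesis
      using True by (intro exI[of _ ?V]) (auto simp: D_def sum_nonneg)
  next
    case False
    have "\<exists>X Y. X \<subseteq> ?V \<and> Y \<subseteq> ?V \<and> \<eta> * \<delta> / 32 * real (card ?V) \<le> real (card X)
      \<and> \<eta> * \<delta> / 32 * real (card ?V) \<le> real (card Y)
      \<and> (\<forall>u\<in>X. \<forall>v\<in>Y. \<eta> * \<delta> / 128000000 / sqrt (real r) \<le> D u v)"
    proof (rule separated_sets_exist[where A = "{..<d}" and p = p and B = B])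
      show "D u u = 0" "D u v = D v u" for u v
        by (simp_all add: D_def power2_commute)
      show "D u w \<le> D u v + D v w" if "u \<in> ?V" "v \<in> ?V" "w \<in> ?V" for u v w
        using tri that by (simp flip: D)
      show "D u v \<le> 4" if "u \<in> ?V" "v \<in> ?V" for u v
      proof -
        have "D u v \<le> (\<Sum>i<d. 2 * (x u $ i)\<^sup>2 + 2 * (x v $ i)\<^sup>2)"
          unfolding D_def
        proof (intro sum_mono)
          fix i
          show "(x u $ i - x v $ i)\<^sup>2 \<le> 2 * (x u $ i)\<^sup>2 + 2 * (x v $ i)\<^sup>2"
            using zero_le_power2[of "x u $ i + x v $ i"] by (simp add: power2_sum power2_diff)
        qed
        then show ?thesis
          using xc(2)[OF that(1)] xc(2)[OF that(2)] by (simp add: sum.distrib flip: sum_distrib_left)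
      qed
      show "(\<Sum>i<d. (p u i - p v i)\<^sup>2) \<le> D u v" if uv: "u \<in> ?V" "v \<in> ?V" for u v
      proof -
        have "P *\<^sub>v (x u - x v) = P *\<^sub>v x u - P *\<^sub>v x v"
          using Pc xc uv by (intro mult_minus_distrib_mat_vec) auto
        then show ?thesis
          using orthogonal_projector_contraction[OF P(1), of "x u - x v"] xc(1) uv
          by (simp flip: D q)
      qed
      show "0 \<le> B S" for S by (simp add: B_def)
      show "rform {..<d} S (p v) - rform {..<d} S (p u) \<le> B S * sqrt (D u v)"
        if uv: "u \<in> ?V" "v \<in> ?V" for S u v
      proof -
        let ?s = "\<lambda>l. if l \<in> S then 1 else - 1 :: real"
        have pw: "p w l = (\<Sum>k<d. P $$ (l, k) * x w $ k)" if "w \<in> ?V" "l < d" for w l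
          using Pc xc(1)[OF that(1)] that(2) by (simp add: p_def scalar_prod_def atLeast0LessThan)
        have "rform {..<d} S (p v) - rform {..<d} S (p u) = rform {..<d} S (\<lambda>l. p v l - p u l)"
          by (simp add: rform_diff)
        also have "\<dots> = (\<Sum>l<d. \<Sum>k<d. ?s l * P $$ (l, k) * (x v $ k - x u $ k))"
          unfolding rform_def using uv
          by (intro sum.cong refl)
            (simp add: pw sum_distrib_left algebra_simps flip: sum_subtractf)
        \<comment> \<open>Moving the projector from the points to the signs lets Cauchy--Schwarz
          pair the projected sign vector with the unprojected difference, whose squared length is
          \<open>D u v\<close>.\<close>
        also have "\<dots> = (\<Sum>k<d. rform {..<d} S (\<lambda>l. P $$ (l, k)) * (x v $ k - x u $ k))"
          unfolding rform_def sum_distrib_right by (rule sum.swap)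
        also have "\<dots> \<le> (\<Sum>k<d. \<bar>rform {..<d} S (\<lambda>l. P $$ (l, k))\<bar> * \<bar>x v $ k - x u $ k\<bar>)"
          by (intro sum_mono) (simp flip: abs_mult)
        also have "\<dots> \<le> B S * L2_set (\<lambda>k. x v $ k - x u $ k) {..<d}"
          unfolding B_def by (rule L2_set_mult_ineq)
        also have "L2_set (\<lambda>k. x v $ k - x u $ k) {..<d} = sqrt (D u v)"
          by (simp add: L2_set_def D_def power2_commute)
        finally show ?thesis .
      qed
      show "ravg {..<d} (\<lambda>S. (B S)\<^sup>2) \<le> real r"
        using ravg_projected_sign_vector[OF P(1)] P(2)
        by (simp add: B_def L2_set_def sum_nonneg)
      have "\<eta> * (\<delta> * (real n)\<^sup>2) \<le> \<eta> * (\<Sum>u\<in>?V. \<Sum>v\<in>?V. D u v)"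
        using D_sum assms(1) by (intro mult_left_mono) auto
      also have "\<dots> \<le> (\<Sum>u\<in>?V. \<Sum>v\<in>?V. \<Sum>i<d. (p u i - p v i)\<^sup>2)"
        using rank by (simp add: D q)
      finally show "\<eta> * \<delta> * (real (card ?V))\<^sup>2 \<le> (\<Sum>u\<in>?V. \<Sum>v\<in>?V. \<Sum>i<d. (p u i - p v i)\<^sup>2)"
        by (simp add: mult.assoc)
    qed (use n \<mu> False in auto)
    then show ?thesis by simp
  qed
  then obtain X Y where XY: "X \<subseteq> ?V" "Y \<subseteq> ?V" "\<eta> * \<delta> / 32 * real n \<le> real (card X)"
    "\<eta> * \<delta> / 32 * real n \<le> real (card Y)"
    and sep: "\<And>u v. u \<in> X \<Longrightarrow> v \<in> Y \<Longrightarrow> \<eta> * \<delta> / 128000000 / sqrt (real r) \<le> D u v"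
    by blast
  have "\<eta> * \<delta> / 128000000 / sqrt (real r) \<le> (l2_norm (x i - x j))\<^sup>2"
    if "i \<in> X" "j \<in> Y" for i j
    unfolding D[OF subsetD[OF XY(1) that(1)] subsetD[OF XY(2) that(2)]] using that by (rule sep)
  with XY show "\<exists>A B. A \<subseteq> ?V \<and> B \<subseteq> ?V \<and> real (card A) \<ge> \<eta> * \<delta> / 32 * real n
      \<and> real (card B) \<ge> \<eta> * \<delta> / 32 * real n
      \<and> (\<forall>i\<in>A. \<forall>j\<in>B. (l2_norm (x i - x j))\<^sup>2 \<ge> \<eta> * \<delta> / 128000000 / sqrt (real r))"
    by (intro exI[of _ X] exI[of _ Y] conjI ballI)
qed

end
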